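(* Let $S=K_1\cup K_2\cup K_3$ be a vertex disjoint union of three cliques (contained in $V_d$ for some $d$) whose weights are pairwise distinct. Then $S$ is $2$-Ramsey if and only if each of $K_1\cup K_2$, $K_1\cup K_3$ and $K_2\cup K_3$ is $2$-Ramsey.
   Context: For $d\ge1$, $[d]=\{1,\dots,d\}$ and $V_d=2^{[d]}$ (the set of all subsets of $[d]$) is the vertex set of the $d$-dimensional hypercube $Q_d$; two sets are adjacent iff their symmetric difference has exactly one element. For $1\le d\le n$, an embedding of $Q_d$ into $Q_n$ is an injective map $\psi:V_d\to V_n$ sending adjacent pairs to adjacent pairs. For $F\subseteq V_d$ and $T\subseteq V_n$, $T$ contains a copy of $F$ if some embedding $\psi:V_d\to V_n$ satisfies $\psi(F)\subseteq T$. A $t$-coloring of $Q_n$ is a map $c:V_n\to[t]$; it contains a monochromatic copy of $F$ if some color class $c^{-1}(i)$ contains a copy of $F$. A set $F\subseteq V_d$ is $t$-Ramsey if there is $n_0$ such that for all $n\ge n_0$ every $t$-coloring of $Q_n$ contains a monochromatic copy of $F$. A clique of weight $a$ and order $k$ is a family $K^{(a)}$ consisting of all $a$-element subsets of a set $K$ with $|K|=k$; $K$ is called its vertex set. A union of cliques is vertex disjoint if the vertex sets of distinct cliques are pairwise disjoint. *)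

theory Defs
  imports "HOL-Library.FuncSet" "HOL-Library.Ramsey"
begin

definition cube_verts :: "nat \<Rightarrow> nat set set" where
  "cube_verts d = Pow {1..d}"

definition cube_adj :: "nat set \<Rightarrow> nat set \<Rightarrow> bool" where
  "cube_adj A B \<longleftrightarrow> card (sym_diff A B) = 1"

text \<open>The requirement \<open>d \<le> n\<close> needs no separate clause: injectivity of \<open>\<psi>\<close> forces it.\<close>

definition cube_embedding :: "nat \<Rightarrow> nat \<Rightarrow> (nat set \<Rightarrow> nat set) \<Rightarrow> bool" where
  "cube_embedding d n \<psi> \<longleftrightarrow>
     \<psi> \<in> cube_verts d \<rightarrow> cube_verts n \<and>
     inj_on \<psi> (cube_verts d) \<and>
     (\<forall>A\<in>cube_verts d. \<forall>B\<in>cube_verts d. cube_adj A B \<longrightarrow> cube_adj (\<psi> A) (\<psi> B))"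

definition contains_copy :: "nat \<Rightarrow> nat \<Rightarrow> nat set set \<Rightarrow> nat set set \<Rightarrow> bool" where
  "contains_copy d n F T \<longleftrightarrow> (\<exists>\<psi>. cube_embedding d n \<psi> \<and> \<psi> ` F \<subseteq> T)"

text \<open>Intended for \<open>F \<subseteq> cube_verts d\<close> only.\<close>

definition cube_ramsey :: "nat \<Rightarrow> nat \<Rightarrow> nat set set \<Rightarrow> bool" where
  "cube_ramsey t d F \<longleftrightarrow>
     (\<exists>n\<^sub>0. \<forall>n\<ge>n\<^sub>0. \<forall>c \<in> cube_verts n \<rightarrow> {1..t}.
        \<exists>i\<in>{1..t}. contains_copy d n F {A \<in> cube_verts n. c A = i})"

text \<open>The clique of weight \<open>a\<close> with vertex set \<open>K\<close> (and order \<open>card K\<close>) is the library's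
  \<open>nsets K a\<close>, the family of all \<open>a\<close>-element subsets of \<open>K\<close>.\<close>

end

theory Submission
  imports Defs
begin

text \<open>
  An embedding of cubes has the form \<open>A \<mapsto> B \<triangle> p(A)\<close>, so by Ramsey's theorem only
  colourings \<open>A \<mapsto> f |A|\<close> matter, and a clique \<open>(a, k)\<close> can be moved, relative to \<open>m = |B|\<close>,
  into the single layer \<open>m + a\<close>, the single layer \<open>m - a\<close>, or into any \<open>k - a + 1\<close> layers
  in steps of two between them.

  For the extreme positions, suppose that a periodic \<open>f\<close> with values \<open>\<plusminus>1\<close> admits no
  monochromatic copy of three cliques. Averaging over a period shows that
  \<open>\<Prod>(1 + T\<^bsup>a\<^esup>) f = 0 = \<Prod>(1 - T\<^bsup>a\<^esup>) f\<close> for the shift \<open>T\<close>, where \<open>a\<close> ranges over the three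
  weights. If all weights have the same 2-adic valuation, then \<open>1 \<plusminus> T\<^bsup>a\<^esup>\<close> divides \<open>1 \<plusminus> T\<^bsup>M\<^esup>\<close>
  for a common odd multiple \<open>M\<close>, which is contradictory. If only two do, then \<open>f\<close> has
  period \<open>2 a\<^sub>3\<close>, so the third clique, if \<open>k - a \<le> 1\<close>, finds room in both colours around every
  layer and is never an obstacle. Pairs with different valuations are Ramsey only if one of
  the two has \<open>k - a \<le> 1\<close>; if two of the three cliques are that flexible, a monochromatic run
  forces longer and longer runs.
\<close>

section \<open>Periodic sign sequences\<close>

lemma periodic_mult:
  fixes h :: "int \<Rightarrow> 'a"
  assumes "\<And>x. h (x + N) = h x"
  shows "h (x + k * N) = h x"
proof (induction k rule: int_induct[where k = 0])
  case (step1 i)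
  then show ?case using assms[of "x + i * N"] by (simp add: algebra_simps)
next
  case (step2 i)
  then show ?case using assms[of "x + (i - 1) * N"] by (simp add: algebra_simps)
qed simp

lemma antiperiodic_mult:
  fixes h :: "int \<Rightarrow> int"
  assumes "\<And>x. h (x + N) = - h x"
  shows "h (x + k * N) = (if even k then h x else - h x)"
proof (induction k rule: int_induct[where k = 0])
  case (step1 i)
  then show ?case using assms[of "x + i * N"] by (auto simp: algebra_simps)
next
  case (step2 i)
  then show ?case using assms[of "x + (i - 1) * N"] by (auto simp: algebra_simps split: if_splits)
qed simp

lemma periodic_mod:
  fixes h :: "int \<Rightarrow> 'a"
  assumes "\<And>x. h (x + N) = h x"
  shows "h (x mod N) = h x"
  using periodic_mult[of h N "x mod N" "x div N", OF assms] by (simp add: algebra_simps)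

lemma sum_periodic_shift:
  fixes h :: "int \<Rightarrow> int"
  assumes per: "\<And>x. h (x + N) = h x" and "N > 0"
  shows "(\<Sum>x\<in>{0..<N}. h (x + s)) = (\<Sum>x\<in>{0..<N}. h x)"
proof (rule sum.reindex_bij_witness[of _ "\<lambda>y. (y - s) mod N" "\<lambda>x. (x + s) mod N"])
  show "((x + s) mod N - s) mod N = x" if "x \<in> {0..<N}" for x
    using that by (simp add: mod_diff_left_eq)
  show "((y - s) mod N + s) mod N = y" if "y \<in> {0..<N}" for y
    using that by (simp add: mod_add_left_eq)
  show "h ((x + s) mod N) = h (x + s)" for x using periodic_mod[of h, OF per] .
qed (use \<open>N > 0\<close> in auto)

section \<open>Three cliques restricted to their extreme positions\<close>

definition sign_seq :: "(int \<Rightarrow> int) \<Rightarrow> bool" where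
  "sign_seq g \<longleftrightarrow> (\<forall>x. g x = 1 \<or> g x = - 1)"

lemma sign_seqD: "sign_seq g \<Longrightarrow> g x = 1 \<or> g x = - 1"
  by (simp add: sign_seq_def)

text \<open>A clique of weight \<open>a\<close> at base layer \<open>m\<close> can be moved into either of the
  layers \<open>m \<plusminus> a\<close>.\<close>

definition blocked :: "(int \<Rightarrow> int) \<Rightarrow> int \<Rightarrow> int \<Rightarrow> int \<Rightarrow> bool" where
  "blocked g a m c \<longleftrightarrow> g (m + a) \<noteq> c \<and> g (m - a) \<noteq> c"

text \<open>With \<open>w a m = g (m + a) + g (m - a)\<close> the hypothesis says that among the three values of
  \<open>w\<close> both \<open>2\<close> and \<open>- 2\<close> occur, so their pairwise products sum to \<open>- 4\<close>. Over a period this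
  makes the autocorrelations in the sum of squares of the left-hand side cancel.\<close>

lemma tetrahedron_sum:
  assumes per: "\<And>x. g (x + N) = g x" and N: "N > 0" and pm: "sign_seq g"
    and bad: "\<And>m c. c \<in> {1, -1} \<Longrightarrow> blocked g a1 m c \<or> blocked g a2 m c \<or> blocked g a3 m c"
  shows "g x + g (x + (a1 + a2)) + g (x + (a1 + a3)) + g (x + (a2 + a3)) = 0"
proof -
  define R where "R k = (\<Sum>x\<in>{0..<N}. g x * g (x + k))" for k
  have cross: "(\<Sum>x\<in>{0..<N}. g (x + u) * g (x + v)) = R (v - u)" for u v
  proof -
    have "g (y + N + (v - u)) = g (y + (v - u))" for y
      using per[of "y + (v - u)"] by (simp add: algebra_simps)
    then have "(\<Sum>x\<in>{0..<N}. (\<lambda>y. g y * g (y + (v - u))) (x + u)) = R (v - u)"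
      unfolding R_def by (intro sum_periodic_shift N) (simp add: per)
    then show ?thesis by simp
  qed
  have R_minus: "R (- k) = R k" for k
    using cross[of k 0] by (simp add: R_def mult.commute)
  have sq: "g x * g x = 1" for x using sign_seqD[OF pm, of x] by auto
  define w where "w a m = g (m + a) + g (m + (- a))" for a m
  have w_bad: "w a1 m * w a2 m + w a1 m * w a3 m + w a2 m * w a3 m = - 4" for m
  proof -
    have "blocked g a m 1 \<longleftrightarrow> w a m = - 2" "blocked g a m (- 1) \<longleftrightarrow> w a m = 2" for a
      using sign_seqD[OF pm, of "m + a"] sign_seqD[OF pm, of "m - a"] by (auto simp: blocked_def w_def)
    then have "w a1 m = - 2 \<or> w a2 m = - 2 \<or> w a3 m = - 2" "w a1 m = 2 \<or> w a2 m = 2 \<or> w a3 m = 2"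
      using bad[of 1 m] bad[of "- 1" m] by auto
    then show ?thesis by (elim disjE) simp_all
  qed
  have w_cross: "(\<Sum>m\<in>{0..<N}. w a m * w b m) = 2 * R (a + b) + 2 * R (a - b)" for a b
  proof -
    have "(\<Sum>m\<in>{0..<N}. w a m * w b m) = R (b - a) + R (- b - a) + (R (b + a) + R (a - b))"
      unfolding w_def ring_distribs sum.distrib cross by simp
    moreover have "- b - a = - (a + b)" "b - a = - (a - b)" by simp_all
    then have "R (- b - a) = R (a + b)" "R (b - a) = R (a - b)" by (simp_all only: R_minus)
    ultimately show ?thesis by (simp add: add.commute)
  qed
  have "(\<Sum>m\<in>{0..<N}. w a1 m * w a2 m + w a1 m * w a3 m + w a2 m * w a3 m) = - 4 * N"
    using N by (simp add: w_bad)
  then have R_sum: "2 * R (a1 + a2) + 2 * R (a1 - a2) + (2 * R (a1 + a3) + 2 * R (a1 - a3))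
      + (2 * R (a2 + a3) + 2 * R (a2 - a3)) = - 4 * N"
    by (simp only: sum.distrib w_cross)
  define e where "e x = g x + g (x + (a1 + a2)) + g (x + (a1 + a3)) + g (x + (a2 + a3))" for x
  have "e x * e x = 4 + 2 * (g (x + 0) * g (x + (a1 + a2)) + g (x + 0) * g (x + (a1 + a3))
      + g (x + 0) * g (x + (a2 + a3)) + g (x + (a1 + a2)) * g (x + (a1 + a3))
      + g (x + (a1 + a2)) * g (x + (a2 + a3)) + g (x + (a1 + a3)) * g (x + (a2 + a3)))" for x
  proof -
    have "(p + q + r + s) * (p + q + r + s) = 4 + 2 * (p * q + p * r + p * s + q * r + q * s + r * s)"
      if "p * p = 1" "q * q = 1" "r * r = 1" "s * s = 1" for p q r s :: int
      using that by (simp add: ring_distribs mult.commute)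
    from this[OF sq sq sq sq] show ?thesis unfolding e_def by simp
  qed
  then have "(\<Sum>x\<in>{0..<N}. e x * e x) = 4 * N + 2 * (R (a1 + a2 - 0) + R (a1 + a3 - 0)
      + R (a2 + a3 - 0) + R (a1 + a3 - (a1 + a2)) + R (a2 + a3 - (a1 + a2)) + R (a2 + a3 - (a1 + a3)))"
    using N by (simp only: sum.distrib sum_distrib_left[symmetric] cross) simp
  also have "\<dots> = 0"
    using R_sum R_minus[of "a2 - a3"] R_minus[of "a1 - a3"] R_minus[of "a1 - a2"] by simp
  finally have "\<forall>x\<in>{0..<N}. e x * e x = 0"
    using sum_nonneg_eq_0_iff[of "{0..<N}" "\<lambda>x. e x * e x"] by simp
  then have "e (x mod N) = 0" using N by simp
  moreover have "e (x mod N) = e x"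
  proof (rule periodic_mod[of e])
    have "g (y + N + a) = g (y + a)" for y a using per[of "y + a"] by (simp add: add_ac)
    then show "e (y + N) = e y" for y by (simp only: e_def per)
  qed
  ultimately show ?thesis by (simp add: e_def)
qed

text \<open>Reflection of the line exchanges the two extreme positions of each clique, so the
  hypothesis survives it. Seen from the opposite corner, sums of an even number of weights turn into
  sums of an odd number: the other tetrahedron inscribed in the box.\<close>

lemma tetrahedron_sum_reflected:
  assumes per: "\<And>x. g (x + N) = g x" and N: "N > 0" and pm: "sign_seq g"
    and bad: "\<And>m c. c \<in> {1, -1} \<Longrightarrow> blocked g a1 m c \<or> blocked g a2 m c \<or> blocked g a3 m c"
  shows "g (x + a1) + g (x + a2) + g (x + a3) + g (x + (a1 + a2 + a3)) = 0"
proof -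
  have "(\<lambda>y. g (- y)) z + (\<lambda>y. g (- y)) (z + (a1 + a2)) + (\<lambda>y. g (- y)) (z + (a1 + a3))
      + (\<lambda>y. g (- y)) (z + (a2 + a3)) = 0" for z
  proof (rule tetrahedron_sum[OF _ N])
    show "g (- (y + N)) = g (- y)" for y using per[of "- y - N"] by simp
    show "sign_seq (\<lambda>y. g (- y))" using pm by (simp add: sign_seq_def)
    show "blocked (\<lambda>y. g (- y)) a1 m c \<or> blocked (\<lambda>y. g (- y)) a2 m c \<or> blocked (\<lambda>y. g (- y)) a3 m c"
      if "c \<in> {1, -1}" for m c
    proof -
      have eq: "- (m + a) = - m - a" "- (m - a) = - m + a" for a by simp_all
      show ?thesis using bad[OF that, of "- m"] unfolding blocked_def eq by blast
    qed
  qed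
  from this[of "- (x + (a1 + a2 + a3))"] show ?thesis by (simp add: algebra_simps)
qed

text \<open>In terms of the shift \<open>T\<close>, the next two lemmas say that \<open>1 + T\<^sup>a\<close> divides \<open>1 + T\<^sup>M\<close>
  when \<open>M\<close> is an odd multiple of \<open>a\<close>, and that \<open>1 - T\<^sup>a\<close> divides \<open>1 - T\<^sup>M\<close> for all multiples.\<close>

lemma plus_plus_common_multiple:
  fixes h :: "int \<Rightarrow> int"
  assumes h: "\<And>x. h x + h (x + a) + h (x + b) + h (x + (a + b)) = 0"
    and M: "M = k * a" "M = l * b" "odd k" "odd l"
  shows "h x + 2 * h (x + M) + h (x + 2 * M) = 0"
proof -
  \<comment> \<open>The factors are exchanged one at a time: first the step \<open>a\<close> becomes
    its odd multiple \<open>M\<close>, then the step \<open>b\<close>.\<close>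
  have "(\<lambda>y. h y + h (y + b)) (x + k * a) = (if even k then h x + h (x + b) else - (h x + h (x + b)))" for x
    by (rule antiperiodic_mult[of "\<lambda>y. h y + h (y + b)"]) (use h in \<open>simp add: algebra_simps eq_neg_iff_add_eq_0\<close>)
  then have 1: "h (x + M) + h (x + M + b) = - (h x + h (x + b))" for x
    using M by simp
  have "(\<lambda>y. h y + h (y + M)) (y + b) = - (h y + h (y + M))" for y
    using 1[of y] by (simp add: algebra_simps)
  then have "(\<lambda>y. h y + h (y + M)) (x + l * b) = (if even l then h x + h (x + M) else - (h x + h (x + M)))"
    by (rule antiperiodic_mult)
  then show ?thesis using M by (simp add: algebra_simps)
qed

lemma minus_minus_common_multiple:
  fixes h :: "int \<Rightarrow> int"
  assumes h: "\<And>x. h x - h (x + a) - h (x + b) + h (x + (a + b)) = 0"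
    and M: "M = k * a" "M = l * b"
  shows "h x - 2 * h (x + M) + h (x + 2 * M) = 0"
proof -
  have "(\<lambda>y. h y - h (y + b)) (x + k * a) = h x - h (x + b)" for x
    by (rule periodic_mult) (use h in \<open>simp add: algebra_simps eq_neg_iff_add_eq_0\<close>)
  then have 1: "h (x + M) - h (x + M + b) = h x - h (x + b)" for x
    using M by simp
  have "(\<lambda>y. h y - h (y + M)) (y + b) = h y - h (y + M)" for y
    using 1[of y] by (simp add: algebra_simps)
  then have "(\<lambda>y. h y - h (y + M)) (x + l * b) = h x - h (x + M)"
    by (rule periodic_mult)
  then show ?thesis using M by (simp add: algebra_simps)
qed

text \<open>Six steps of a nonzero integer difference overshoot an interval of length 4. Six is the
  least even number that does so, and evenness cancels the sign \<open>(-1) ^ n\<close> in the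
  alternating case.\<close>

lemma bounded_arithmetic_progression:
  fixes a b :: int
  assumes "a \<le> 2" "- 2 \<le> a" "a + 6 * (b - a) \<le> 2" "- 2 \<le> a + 6 * (b - a)"
  shows "b = a"
proof -
  have "6 * b - 5 * a \<le> 2" "- 2 \<le> 6 * b - 5 * a" using assms(3,4) by (simp_all add: algebra_simps)
  then show ?thesis using assms(1,2) by linarith
qed

text \<open>The recurrence has \<open>-1\<close> as a double root: along multiples of
  \<open>M\<close> a solution is \<open>(-1) ^ n\<close> times a linear function of
  \<open>n\<close>, and boundedness removes the slope.\<close>

lemma bounded_double_root_plus:
  fixes h :: "int \<Rightarrow> int"
  assumes rec: "\<And>x. h x + 2 * h (x + M) + h (x + 2 * M) = 0" and bd: "\<And>x. h x \<le> 2" "\<And>x. - 2 \<le> h x"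
  shows "h (x + M) = - h x"
proof -
  have "h (x + of_nat n * M) = (-1) ^ n * (h x - of_nat n * (h x + h (x + M)))
    \<and> h (x + of_nat (Suc n) * M) = (-1) ^ Suc n * (h x - of_nat (Suc n) * (h x + h (x + M)))" for n
  proof (induction n)
    case (Suc n)
    then show ?case using rec[of "x + of_nat n * M"] by (simp add: algebra_simps)
  qed simp
  from conjunct1[OF this[of 6]] have "h (x + 6 * M) = h x + 6 * (- h (x + M) - h x)" by simp
  then have "- h (x + M) = h x"
    using bd[of x] bd[of "x + 6 * M"] by (intro bounded_arithmetic_progression) simp_all
  then show ?thesis by simp
qed

text \<open>With \<open>1\<close> as a double root, the values along multiples of \<open>M\<close>
  form an arithmetic progression, which is constant because it is bounded.\<close>

lemma bounded_double_root_minus: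
  fixes h :: "int \<Rightarrow> int"
  assumes rec: "\<And>x. h x - 2 * h (x + M) + h (x + 2 * M) = 0" and bd: "\<And>x. h x \<le> 2" "\<And>x. - 2 \<le> h x"
  shows "h (x + M) = h x"
proof -
  have "h (x + of_nat n * M) = h x + of_nat n * (h (x + M) - h x)
    \<and> h (x + of_nat (Suc n) * M) = h x + of_nat (Suc n) * (h (x + M) - h x)" for n
  proof (induction n)
    case (Suc n)
    then show ?case using rec[of "x + of_nat n * M"] by (simp add: algebra_simps)
  qed simp
  from conjunct1[OF this[of 6]] have "h (x + 6 * M) = h x + 6 * (h (x + M) - h x)" by simp
  then have "h (x + M) = h x"
    using bd[of x] bd[of "x + 6 * M"] by (intro bounded_arithmetic_progression) simp_all
  then show ?thesis by simp
qed

text \<open>The two tetrahedron sums add up to \<open>\<Prod>(1 + T\<^bsup>a\<^esup>) g = 0\<close> and differ by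
  \<open>\<Prod>(1 - T\<^bsup>a\<^esup>) g = 0\<close>. Below, \<open>p = (1 + T\<^bsup>a3\<^esup>) g\<close> and \<open>q = (1 - T\<^bsup>a3\<^esup>) g\<close>.\<close>

lemma unblocked_period:
  assumes per: "\<And>x. g (x + N) = g x" and N: "N > 0" and pm: "sign_seq g"
    and bad: "\<And>m c. c \<in> {1, -1} \<Longrightarrow> blocked g a1 m c \<or> blocked g a2 m c \<or> blocked g a3 m c"
    and M: "M = k1 * a1" "M = k2 * a2" "odd k1" "odd k2"
  shows "g (x + 2 * a3) = g x" and "g (x + M) + g (x + M + a3) = - (g x + g (x + a3))"
    and "g (x + M) - g (x + M + a3) = g x - g (x + a3)"
proof -
  have e: "g x + g (x + (a1 + a2)) + g (x + (a1 + a3)) + g (x + (a2 + a3)) = 0" for x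
    by (rule tetrahedron_sum[OF per N pm bad])
  have o: "g (x + a1) + g (x + a2) + g (x + a3) + g (x + (a1 + a2 + a3)) = 0" for x
    by (rule tetrahedron_sum_reflected[OF per N pm bad])
  define p where "p x = g x + g (x + a3)" for x
  define q where "q x = g x - g (x + a3)" for x
  have "p x + p (x + a1) + p (x + a2) + p (x + (a1 + a2)) = 0" for x
    using e[of x] o[of x] unfolding p_def by (simp add: add.assoc)
  note plus = plus_plus_common_multiple[OF this M]
  have "q x - q (x + a1) - q (x + a2) + q (x + (a1 + a2)) = 0" for x
    using e[of x] o[of x] unfolding q_def by (simp add: add.assoc)
  note minus = minus_minus_common_multiple[OF this M(1,2)]
  have bd: "p x \<le> 2" "- 2 \<le> p x" "q x \<le> 2" "- 2 \<le> q x" for x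
    using sign_seqD[OF pm, of x] sign_seqD[OF pm, of "x + a3"] by (auto simp: p_def q_def)
  show pM: "g (x + M) + g (x + M + a3) = - (g x + g (x + a3))" for x
    using bounded_double_root_plus[OF plus bd(1,2), of x] by (simp add: p_def)
  show qM: "g (x + M) - g (x + M + a3) = g x - g (x + a3)" for x
    using bounded_double_root_minus[OF minus bd(3,4), of x] by (simp add: q_def)
  \<comment> \<open>Adding and subtracting \<open>pM\<close> and \<open>qM\<close> gives
    \<open>g (x + M) = - g (x + a3)\<close> and \<open>g (x + M + a3) = - g x\<close>; the second is
    compared with the first at \<open>x + a3\<close>.\<close>
  show "g (x + 2 * a3) = g x"
    using pM[of x] pM[of "x + a3"] qM[of x] qM[of "x + a3"] by (simp add: algebra_simps)
qed

text \<open>For the step \<open>a3\<close> the sequence \<open>p\<close> is periodic and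
  \<open>q\<close> antiperiodic; for the step \<open>M\<close> it is the other way round. Comparing
  the two along \<open>k * a3 = l * M\<close>, \<open>odd l\<close> forces \<open>p = 0\<close> and
  \<open>odd k\<close> forces \<open>q = 0\<close>. Both cannot vanish, since \<open>g\<close> has
  no zeros; if \<open>q\<close> does, \<open>M\<close> is an antiperiod of \<open>g\<close>, and if
  \<open>p\<close> does, \<open>a3\<close> is.\<close>

lemma unblocked_antiperiod:
  assumes per: "\<And>x. g (x + N) = g x" and N: "N > 0" and pm: "sign_seq g"
    and bad: "\<And>m c. c \<in> {1, -1} \<Longrightarrow> blocked g a1 m c \<or> blocked g a2 m c \<or> blocked g a3 m c"
    and M: "M = k1 * a1" "M = k2 * a2" "odd k1" "odd k2"
    and C: "k * a3 = l * M" "odd k \<or> odd l"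
  shows "\<not> (odd k \<and> odd l)" and "\<exists>M'. \<forall>x. g (x + M') = - g x"
proof -
  note facts = unblocked_period[OF per N pm bad M]
  define p where "p x = g x + g (x + a3)" for x
  define q where "q x = g x - g (x + a3)" for x
  have pa: "p (x + a3) = p x" and qa: "q (x + a3) = - q x" for x
    using facts(1)[of x] by (simp_all add: p_def q_def add.assoc)
  have pM: "p (x + M) = - p x" and qM: "q (x + M) = q x" for x
    using facts(2,3)[of x] by (simp_all add: p_def q_def)
  have l: "p x = 0" if "odd l" for x
    using antiperiodic_mult[of p M x l, OF pM] periodic_mult[of p a3 x k, OF pa] that C(1) by simp
  have k: "q x = 0" if "odd k" for x
    using antiperiodic_mult[of q a3 x k, OF qa] periodic_mult[of q M x l, OF qM] that C(1) by simp
  have g0: "g x \<noteq> 0" for x using sign_seqD[OF pm, of x] by auto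
  show "\<not> (odd k \<and> odd l)"
  proof
    assume "odd k \<and> odd l"
    then show False using k[of 0] l[of 0] g0[of 0] by (simp add: p_def q_def)
  qed
  show "\<exists>M'. \<forall>x. g (x + M') = - g x"
  proof (cases "odd k")
    case True
    have "g (x + M) = - g x" for x
      using k[OF True, of x] k[OF True, of "x + M"] facts(2)[of x] by (simp add: q_def)
    then show ?thesis by blast
  next
    case False
    then have "p x = 0" for x using l C(2) by blast
    then have "g (x + a3) = - g x" for x by (simp add: p_def eq_neg_iff_add_eq_0 add.commute[of "g (x + a3)"])
    then show ?thesis by blast
  qed
qed

text \<open>A common odd multiple \<open>M\<close> expresses equal 2-adic valuations. Relating
  \<open>a3\<close> to \<open>M\<close> by the multipliers \<open>k3\<close> and \<open>1\<close>,
  both odd, contradicts \<open>unblocked_antiperiod\<close>.\<close>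

lemma unblocked_if_equal_valuations:
  assumes per: "\<And>x. g (x + N) = g x" and N: "N > 0" and pm: "sign_seq g"
    and M: "M = k1 * a1" "M = k2 * a2" "M = k3 * a3" "odd k1" "odd k2" "odd k3"
  shows "\<exists>m. \<exists>c\<in>{1, -1}. \<not> blocked g a1 m c \<and> \<not> blocked g a2 m c \<and> \<not> blocked g a3 m c"
proof (rule ccontr)
  assume "\<not> ?thesis"
  then have bad: "blocked g a1 m c \<or> blocked g a2 m c \<or> blocked g a3 m c" if "c \<in> {1, -1}" for m c
    using that by blast
  have "k3 * a3 = 1 * M" "odd k3 \<or> odd (1 :: int)" using M by simp_all
  from unblocked_antiperiod(1)[OF per N pm bad M(1,2,4,5) this] show False using M(6) by simp
qed

section \<open>Intermediate positions and flexible cliques\<close>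

text \<open>\<open>b + 1\<close> is the number of layers (in units of two) occupied by a clique of weight \<open>2 * a\<close>
  and order \<open>2 * a + b\<close> when it is moved to neither extreme position.\<close>

definition avail :: "(int \<Rightarrow> int) \<Rightarrow> int \<Rightarrow> int \<Rightarrow> int \<Rightarrow> int \<Rightarrow> bool" where
  "avail g a b m c \<longleftrightarrow> \<not> blocked g a m c \<or>
     (\<exists>j. - a \<le> j \<and> j + b \<le> a \<and> (\<forall>t\<in>{0..b}. g (m + j + t) = c))"

text \<open>These cliques find room once two neighbouring layers within reach have equal colour. For
  \<open>b = 1\<close> an alternating sequence leaves only the layers \<open>m + a\<close> and
  \<open>m - a\<close>, and \<open>even a\<close> gives them the parity of \<open>m\<close>.\<close>

definition flexible :: "int \<Rightarrow> int \<Rightarrow> bool" where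
  "flexible a b \<longleftrightarrow> a > 0 \<and> (b = 0 \<or> b = 1 \<and> even a)"

text \<open>For \<open>a = 1\<close> only one of the two layers has to lie within reach, so the
  window may have radius 2. A run is then visible from one step outside it, which lets runs grow in
  \<open>good_if_two_flexible\<close>.\<close>

lemma avail_if_double:
  assumes "flexible a b" and y: "g y = c" "g (y + 1) = c" "m - max a 2 \<le> y" "y + 1 \<le> m + max a 2"
  shows "avail g a b m c"
proof -
  have a: "a > 0" "b = 0 \<or> b = 1 \<and> even a" using assms(1) by (auto simp: flexible_def)
  consider "a = 1" "b = 0" | "a \<ge> 2" "b = 0" | "a \<ge> 2" "b = 1"
    using a by (cases "a = 1") auto
  then show ?thesis
  proof cases
    case 1
    then have "- a \<le> y - m \<and> y - m + b \<le> a \<or> - a \<le> y + 1 - m \<and> y + 1 - m + b \<le> a" using y by auto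
    moreover have "g (m + (y - m) + t) = c" "g (m + (y + 1 - m) + t) = c" if "t \<in> {0..b}" for t
      using 1 y that by (auto simp: add.commute)
    ultimately show ?thesis unfolding avail_def by blast
  next
    case 2
    then have "- a \<le> y - m \<and> y - m + b \<le> a" using y by auto
    moreover have "g (m + (y - m) + t) = c" if "t \<in> {0..b}" for t using 2 y that by auto
    ultimately show ?thesis unfolding avail_def by blast
  next
    case 3
    then have "- a \<le> y - m \<and> y - m + b \<le> a" using y by auto
    moreover have "g (m + (y - m) + t) = c" if "t \<in> {0..b}" for t
    proof -
      have "t = 0 \<or> t = 1" using that 3 by auto
      then show ?thesis using y by auto
    qed
    ultimately show ?thesis unfolding avail_def by blast
  qed
qed

lemma avail_at_point:
  assumes "a > 0" "g m = c \<or> g (m + 1) = c"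
  shows "avail g a 0 m c"
proof -
  obtain j where "j = 0 \<or> j = 1" "g (m + j) = c"
    using assms(2) by (metis add.right_neutral)
  then show ?thesis using assms(1) unfolding avail_def by (intro disjI2 exI[of _ j]) auto
qed

lemma alternating_parity:
  fixes g :: "int \<Rightarrow> int"
  assumes alt: "\<And>y. g (y + 1) = - g y" and par: "even (x - y)"
  shows "g x = g y"
proof -
  obtain k where "x - y = 2 * k" using par by blast
  then have "x = y + (2 * k) * 1" by linarith
  then show ?thesis using antiperiodic_mult[of g 1 y "2 * k", OF alt] by simp
qed

lemma no_double_alternating:
  assumes "sign_seq g" "\<not> (\<exists>y. g (y + 1) = g y)"
  shows "g (y + 1) = - g y"
proof -
  have "g (y + 1) \<noteq> g y" using assms(2) by blast
  then show ?thesis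
    using sign_seqD[OF assms(1), of y] sign_seqD[OF assms(1), of "y + 1"] by auto
qed

text \<open>\<open>e\<close> stands for the weight of another clique, which attains the colour
  \<open>g e\<close> at base layer \<open>0\<close>. If \<open>b = 0\<close>, the layers
  \<open>0\<close> and \<open>1\<close> offer both colours; otherwise \<open>a\<close> and
  \<open>e\<close> are even and the extreme layer \<open>a\<close> has the colour of
  \<open>e\<close>.\<close>

lemma flexible_avail_alternating:
  assumes pm: "sign_seq g" and alt: "\<And>y. g (y + 1) = - g y"
    and "flexible a b" and par: "b = 0 \<or> even e" and c: "c = g e"
  shows "avail g a b 0 c"
proof (cases "b = 0")
  case True
  then have "a > 0" using assms by (simp add: flexible_def)
  moreover have "g 0 = c \<or> g (0 + 1) = c"
    using sign_seqD[OF pm, of 0] sign_seqD[OF pm, of e] alt[of 0] c by auto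
  ultimately show ?thesis using avail_at_point[of a g 0 c] True by simp
next
  case False
  then have "even a" "even e" using assms by (auto simp: flexible_def)
  then have "g (0 + a) = c" using alternating_parity[of g "0 + a" e, OF alt] c by simp
  then show ?thesis by (simp add: avail_def blocked_def)
qed

text \<open>One embedding moves all cliques, hence one base layer and one colour for all of them;
  the positions relative to that layer are chosen independently.\<close>

definition good :: "(int \<times> int) set \<Rightarrow> (int \<Rightarrow> int) \<Rightarrow> int \<Rightarrow> bool" where
  "good S g m \<longleftrightarrow> (\<exists>c\<in>{1, -1}. \<forall>(a, b)\<in>S. avail g a b m c)"

text \<open>An alternating sequence is settled at base layer \<open>0\<close>. Any other has a run
  of two and, without a good base layer, runs of every length; a long one contains all extreme
  layers of some base layer.\<close>

lemma good_if_two_flexible: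
  assumes pm: "sign_seq g" and flex: "flexible a1 b1" "flexible a2 b2"
    and par: "b1 = 0 \<or> even a3" "b2 = 0 \<or> even a3"
  shows "\<exists>m. good {(a1, b1), (a2, b2), (a3, b3)} g m"
proof (cases "\<exists>y. g (y + 1) = g y")
  case False
  have alt: "g (y + 1) = - g y" for y by (rule no_double_alternating[OF pm False])
  define c where "c = g a3"
  have "avail g a1 b1 0 c" by (rule flexible_avail_alternating[OF pm alt flex(1) par(1) c_def])
  moreover have "avail g a2 b2 0 c" by (rule flexible_avail_alternating[OF pm alt flex(2) par(2) c_def])
  moreover have "avail g a3 b3 0 c" by (simp add: avail_def blocked_def c_def)
  moreover have "c \<in> {1, -1}" using sign_seqD[OF pm, of a3] by (auto simp: c_def)
  ultimately show ?thesis unfolding good_def by blast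
next
  case True
  show ?thesis
  proof (rule ccontr)
    assume no: "\<not> ?thesis"
    \<comment> \<open>Near a run of colour \<open>c\<close> the flexible cliques can take colour \<open>c\<close>, so the third one
      cannot: at distance \<open>a3\<close> there is a longer run of colour \<open>- c\<close>.\<close>
    have run: "\<exists>x c. c \<in> {1, -1} \<and> (\<forall>y\<in>{x..x + 1 + of_nat n}. g y = c)" for n
    proof (induction n)
      case 0
      from True obtain y where y: "g (y + 1) = g y" ..
      have "\<forall>z\<in>{y..y + 1 + of_nat 0}. g z = g y"
      proof
        fix z assume "z \<in> {y..y + 1 + of_nat 0}"
        then have "z = y \<or> z = y + 1" by auto
        then show "g z = g y" using y by auto
      qed
      moreover have "g y \<in> {1, -1}" using sign_seqD[OF pm] by simp
      ultimately show ?case by blast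
    next
      case (Suc n)
      from Suc.IH obtain x c where c: "c \<in> {1, -1}" and run: "\<And>y. x \<le> y \<Longrightarrow> y \<le> x + 1 + of_nat n \<Longrightarrow> g y = c"
        by (meson atLeastAtMost_iff)
      have "g z = - c" if z: "z \<in> {x - 1 + a3..x - 1 + a3 + 1 + of_nat (Suc n)}" for z
      proof -
        define m where "m = z - a3"
        have m: "x - 1 \<le> m" "m \<le> x + 1 + of_nat n" using z by (auto simp: m_def)
        obtain y where y: "x \<le> y" "y + 1 \<le> x + 1 + of_nat n" "m - 2 \<le> y" "y + 1 \<le> m + 2"
        proof
          show "x \<le> max x (m - 1)" "max x (m - 1) + 1 \<le> x + 1 + of_nat n" "m - 2 \<le> max x (m - 1)"
            "max x (m - 1) + 1 \<le> m + 2" using m by auto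
        qed
        have "avail g a1 b1 m c" "avail g a2 b2 m c"
          using y run[of y] run[of "y + 1"] by (auto intro!: avail_if_double[OF flex(1), of g y]
              avail_if_double[OF flex(2), of g y])
        then have "\<not> avail g a3 b3 m c" using no c unfolding good_def by blast
        then have "g (m + a3) \<noteq> c" by (simp add: avail_def blocked_def)
        then show ?thesis using sign_seqD[OF pm, of z] c by (auto simp: m_def)
      qed
      then show ?case using c by (intro exI[of _ "x - 1 + a3"] exI[of _ "- c"]) auto
    qed
    define r where "r = max a1 (max a2 \<bar>a3\<bar>)"
    obtain x c where c: "c \<in> {1, -1}" and run': "\<forall>y\<in>{x..x + 1 + of_nat (nat (2 * r))}. g y = c"
      using run[of "nat (2 * r)"] by blast
    have "a1 > 0" using flex by (simp add: flexible_def)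
    then have r: "r \<ge> 0" "\<bar>a\<bar> \<le> r" if "a \<in> {a1, a2, a3}" for a
      using that flex by (auto simp: r_def flexible_def)
    have "g (x + r + a) = c" if "a \<in> {a1, a2, a3}" for a
      using r[OF that] by (intro run'[rule_format]) auto
    then have "avail g a1 b1 (x + r) c" "avail g a2 b2 (x + r) c" "avail g a3 b3 (x + r) c"
      using flex by (auto simp: avail_def blocked_def flexible_def)
    then show False using no c unfolding good_def by blast
  qed
qed

text \<open>Failure blocks the extreme positions of some clique for every layer and colour, so
  \<open>g\<close> has period \<open>2 * a3\<close> and an antiperiod. It is not alternating, as
  base layer \<open>0\<close> would then do. Hence neighbouring equal layers exist, in both colours
  by antiperiodicity and in every period. The third clique fits everywhere, and the first two
  decide.\<close>

lemma good_if_one_flexible: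
  assumes per: "\<And>x. g (x + N) = g x" and N: "N > 0" and pm: "sign_seq g"
    and flex: "flexible a3 b3" and par: "b3 = 0 \<or> even a1"
    and M: "M = k1 * a1" "M = k2 * a2" "odd k1" "odd k2"
    and C: "k * a3 = l * M" "odd k \<or> odd l"
  shows "\<exists>m. good {(a1, b1), (a2, b2), (a3, b3)} g m"
proof (rule ccontr)
  assume no: "\<not> ?thesis"
  have bad: "blocked g a1 m c \<or> blocked g a2 m c \<or> blocked g a3 m c" if "c \<in> {1, -1}" for m c
    using no that unfolding good_def avail_def by blast
  have double: "\<exists>y. g (y + 1) = g y"
  proof (rule ccontr)
    assume False: "\<not> (\<exists>y. g (y + 1) = g y)"
    have alt: "g (y + 1) = - g y" for y by (rule no_double_alternating[OF pm False])
    have "even a1 \<longleftrightarrow> even a2" using M by (metis even_mult_iff)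
    then have "g (0 + a2) = g (0 + a1)" by (intro alternating_parity[of g, OF alt]) simp
    then have "avail g a1 b1 0 (g a1)" "avail g a2 b2 0 (g a1)"
      by (simp_all add: avail_def blocked_def)
    moreover have "avail g a3 b3 0 (g a1)" by (rule flexible_avail_alternating[OF pm alt flex par refl])
    moreover have "g a1 \<in> {1, -1}" using sign_seqD[OF pm] by simp
    ultimately show False using no unfolding good_def by blast
  qed
  obtain M' where M': "\<And>x. g (x + M') = - g x"
    using unblocked_antiperiod(2)[OF per N pm bad M C] by blast
  have per3: "g (x + 2 * a3) = g x" for x by (rule unblocked_period(1)[OF per N pm bad M])
  have a3: "a3 > 0" using flex by (simp add: flexible_def)
  have av: "avail g a3 b3 m c" if "c \<in> {1, -1}" for m c
  proof -
    obtain y where y: "g (y + 1) = c" "g y = c"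
    proof -
      obtain z where z: "g (z + 1) = g z" using double ..
      show ?thesis
      proof (cases "g z = c")
        case False
        then have "g (z + M') = c" "g (z + M' + 1) = c"
          using z M'[of z] M'[of "z + 1"] sign_seqD[OF pm, of z] \<open>c \<in> {1, -1}\<close>
          by (auto simp: add_ac)
        then show ?thesis using that by blast
      qed (use z that in auto)
    qed
    \<comment> \<open>The pair of equal layers is moved by a multiple of the period so that it
      starts at \<open>m - a3 + s\<close>; the strict bound \<open>s < 2 * a3\<close> keeps its
      second layer within \<open>m + a3\<close>.\<close>
    define s where "s = (y - (m - a3)) mod (2 * a3)"
    have s: "0 \<le> s" "s < 2 * a3" using a3 by (simp_all add: s_def)
    have "g (m - a3 + s + i) = g (y + i)" for i
    proof -
      have "y + i = m - a3 + s + i + (y - (m - a3)) div (2 * a3) * (2 * a3)"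
        unfolding s_def by (simp add: minus_mult_div_eq_mod[symmetric] algebra_simps)
      then show ?thesis using periodic_mult[of g "2 * a3", OF per3] by metis
    qed
    from this[of 0] this[of 1] show ?thesis
      using s y by (intro avail_if_double[OF flex, of g "m - a3 + s"]) auto
  qed
  \<comment> \<open>Only the first two cliques remain to be placed, so \<open>a2\<close> also fills
    the slot of the third weight.\<close>
  obtain m c where "c \<in> {1, -1}" "\<not> blocked g a1 m c" "\<not> blocked g a2 m c"
    using unblocked_if_equal_valuations[OF per N pm M(1,2,2) M(3,4,4)] by blast
  then have "avail g a1 b1 m c" "avail g a2 b2 m c" "avail g a3 b3 m c"
    using av by (auto simp: avail_def)
  then show False using no \<open>c \<in> {1, -1}\<close> unfolding good_def by blast
qed

section \<open>2-adic valuations and the pair condition\<close>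

text \<open>Equality of 2-adic valuations, with \<open>0\<close> equivalent only to itself.\<close>

definition same_val :: "int \<Rightarrow> int \<Rightarrow> bool" where
  "same_val a a' \<longleftrightarrow> (\<exists>k l. odd k \<and> odd l \<and> k * a = l * a')"

lemma same_valE:
  assumes "same_val a a'"
  obtains k l where "odd k" "odd l" "k * a = l * a'"
  using assms unfolding same_val_def by blast

lemma same_val_sym: "same_val a a' \<Longrightarrow> same_val a' a"
  unfolding same_val_def by metis

lemma same_val_trans:
  assumes "same_val a b" "same_val b c"
  shows "same_val a c"
proof -
  obtain k l k' l' where "odd k" "odd l" "k * a = l * b" "odd k'" "odd l'" "k' * b = l' * c"
    using assms by (metis same_valE)
  then have "odd (k' * k)" "odd (l * l')" "k' * k * a = l * l' * c"
    by (simp_all add: mult.assoc)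
  then show ?thesis unfolding same_val_def by blast
qed

lemma same_val_parity: "same_val a a' \<Longrightarrow> even a \<longleftrightarrow> even a'"
  by (elim same_valE) (metis even_mult_iff)

lemma same_val_odd: "odd a \<Longrightarrow> odd a' \<Longrightarrow> same_val a a'"
  unfolding same_val_def by (intro exI[of _ a'] exI[of _ a]) simp

lemma coprime_multipliers:
  fixes a a' :: int
  assumes "a \<noteq> 0"
  obtains k l where "k * a = l * a'" "odd k \<or> odd l"
proof -
  have "a' div gcd a a' * a = a div gcd a a' * a'"
    by (metis dvd_div_mult dvd_div_mult_self gcd_dvd1 gcd_dvd2 mult.commute)
  moreover have "coprime (a div gcd a a') (a' div gcd a a')"
    using assms by (intro div_gcd_coprime) simp
  then have "odd (a' div gcd a a') \<or> odd (a div gcd a a')"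
    by (metis coprime_common_divisor odd_one)
  ultimately show ?thesis using that by blast
qed

text \<open>What the Ramsey property amounts to for two cliques of distinct weights \<open>2 * a\<close>, \<open>2 * a'\<close>
  and orders \<open>2 * a + b\<close>, \<open>2 * a' + b'\<close>.\<close>

definition pair_ok :: "int \<Rightarrow> int \<Rightarrow> int \<Rightarrow> int \<Rightarrow> bool" where
  "pair_ok a b a' b' \<longleftrightarrow> same_val a a' \<or> a > 0 \<and> b = 0 \<or> a' > 0 \<and> b' = 0 \<or>
     even a \<and> even a' \<and> (a > 0 \<and> b = 1 \<or> a' > 0 \<and> b' = 1)"

lemma pair_ok_sym: "pair_ok a b a' b' \<Longrightarrow> pair_ok a' b' a b"
  unfolding pair_ok_def using same_val_sym by blast

lemma pair_ok_flexible:
  assumes "pair_ok a b a' b'" "\<not> same_val a a'"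
  shows "flexible a b \<and> (b = 0 \<or> even a') \<or> flexible a' b' \<and> (b' = 0 \<or> even a)"
  using assms unfolding pair_ok_def flexible_def by auto

text \<open>Equal valuations imply equal parity, so the third clique is flexible enough for both of
  the others or for neither. If for neither, the pair conditions make both of the others
  flexible.\<close>

lemma good_if_two_same_val:
  assumes per: "\<And>x. g (x + N) = g x" and N: "N > 0" and pm: "sign_seq g"
    and same: "same_val a1 a2" "\<not> same_val a1 a3"
    and ok: "pair_ok a1 b1 a3 b3" "pair_ok a2 b2 a3 b3"
  shows "\<exists>m. good {(a1, b1), (a2, b2), (a3, b3)} g m"
proof -
  have nsame: "\<not> same_val a2 a3" using same same_val_trans by blast
  have par: "even a1 \<longleftrightarrow> even a2" using same(1) by (rule same_val_parity)
  show ?thesis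
  proof (cases "flexible a3 b3 \<and> (b3 = 0 \<or> even a1)")
    case True
    obtain k l where kl: "odd k" "odd l" "k * a1 = l * a2" using same(1) by (rule same_valE)
    have "a3 \<noteq> 0" using True by (simp add: flexible_def)
    then obtain k' l' where "k' * a3 = l' * (k * a1)" "odd k' \<or> odd l'"
      by (rule coprime_multipliers)
    then show ?thesis
      using good_if_one_flexible[OF per N pm conjunct1[OF True] conjunct2[OF True] refl kl(3) kl(1,2)]
      by blast
  next
    case False
    then have "flexible a1 b1 \<and> (b1 = 0 \<or> even a3)" "flexible a2 b2 \<and> (b2 = 0 \<or> even a3)"
      using pair_ok_flexible[OF ok(1) same(2)] pair_ok_flexible[OF ok(2) nsame] par by blast+
    then show ?thesis using good_if_two_flexible[OF pm] by blast
  qed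
qed

lemma good_if_pairs_ok:
  assumes per: "\<And>x. g (x + N) = g x" and N: "N > 0" and pm: "sign_seq g"
    and ok: "pair_ok a1 b1 a2 b2" "pair_ok a1 b1 a3 b3" "pair_ok a2 b2 a3 b3"
  shows "\<exists>m. good {(a1, b1), (a2, b2), (a3, b3)} g m"
proof -
  have perm: "{(a1, b1), (a3, b3), (a2, b2)} = {(a1, b1), (a2, b2), (a3, b3)}"
    "{(a2, b2), (a3, b3), (a1, b1)} = {(a1, b1), (a2, b2), (a3, b3)}" by auto
  consider "same_val a1 a2" "same_val a1 a3" | "same_val a1 a2" "\<not> same_val a1 a3"
    | "same_val a1 a3" "\<not> same_val a1 a2" | "same_val a2 a3" "\<not> same_val a2 a1"
    | "\<not> same_val a1 a2" "\<not> same_val a1 a3" "\<not> same_val a2 a3"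
    using same_val_sym by blast
  then show ?thesis
  proof cases
    case 1
    obtain k l where kl: "odd k" "odd l" "k * a1 = l * a2" using 1(1) by (rule same_valE)
    obtain k' l' where kl': "odd k'" "odd l'" "k' * a1 = l' * a3" using 1(2) by (rule same_valE)
    have eqs: "k * (k' * a1) = k * k' * a1" "k * (k' * a1) = k' * l * a2" "k * (k' * a1) = k * l' * a3"
      using kl(3) kl'(3) by (simp, metis mult.assoc mult.left_commute, metis mult.assoc)
    have odds: "odd (k * k')" "odd (k' * l)" "odd (k * l')" using kl kl' by simp_all
    obtain m c where "c \<in> {1, -1}" "\<not> blocked g a1 m c" "\<not> blocked g a2 m c" "\<not> blocked g a3 m c"
      using unblocked_if_equal_valuations[OF per N pm eqs odds] by blast
    then show ?thesis unfolding good_def avail_def by auto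
  next
    case 2
    show ?thesis by (rule good_if_two_same_val[OF per N pm 2 ok(2,3)])
  next
    case 3
    show ?thesis
      using good_if_two_same_val[OF per N pm 3 ok(1) pair_ok_sym[OF ok(3)]] unfolding perm .
  next
    case 4
    show ?thesis
      using good_if_two_same_val[OF per N pm 4 ok(1,2)[THEN pair_ok_sym]] unfolding perm .
  next
    case 5
    have odd: "even a1 \<or> even a2" "even a1 \<or> even a3" "even a2 \<or> even a3"
      using 5 same_val_odd by blast+
    have two: "\<exists>m. good {(x1, y1), (x2, y2), (x3, y3)} g m"
      if "flexible x1 y1" "flexible x2 y2" "y1 = 0 \<or> even x3" "y2 = 0 \<or> even x3" for x1 y1 x2 y2 x3 y3
      using good_if_two_flexible[OF pm that] .
    have even: "flexible a b \<Longrightarrow> b = 0 \<or> even a" for a b by (auto simp: flexible_def)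
    \<comment> \<open>Two inflexible cliques would violate their pair condition. If exactly one is
      inflexible, its pair conditions give the claim with it in the third place; if none is, an even
      weight goes there, at most one weight being odd.\<close>
    have "(flexible a1 b1 \<and> flexible a2 b2 \<and> (b1 = 0 \<or> even a3) \<and> (b2 = 0 \<or> even a3)) \<or>
      (flexible a1 b1 \<and> flexible a3 b3 \<and> (b1 = 0 \<or> even a2) \<and> (b3 = 0 \<or> even a2)) \<or>
      (flexible a2 b2 \<and> flexible a3 b3 \<and> (b2 = 0 \<or> even a1) \<and> (b3 = 0 \<or> even a1))"
      using pair_ok_flexible[OF ok(1) 5(1)] pair_ok_flexible[OF ok(2) 5(2)]
        pair_ok_flexible[OF ok(3) 5(3)] odd even by blast
    then show ?thesis
      using two[of a1 b1 a2 b2 a3 b3] two[of a1 b1 a3 b3 a2 b2] two[of a2 b2 a3 b3 a1 b1]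
      unfolding perm by blast
  qed
qed

section \<open>From periodic to arbitrary sequences\<close>

lemma good_local:
  assumes "\<And>i. - W \<le> i \<Longrightarrow> i \<le> W \<Longrightarrow> g (m + i) = g' (m' + i)"
    and "\<And>a b. (a, b) \<in> S \<Longrightarrow> 0 \<le> a \<and> a \<le> W" and "good S g m"
  shows "good S g' m'"
proof -
  have "avail g' a b m' c" if "(a, b) \<in> S" "avail g a b m c" for a b c
  proof -
    have W: "0 \<le> a" "a \<le> W" using assms(2) that(1) by blast+
    have "g' (m' + a) = g (m + a)" "g' (m' - a) = g (m - a)"
      using assms(1)[of a] assms(1)[of "- a"] W by simp_all
    moreover have "g' (m' + j + t) = c"
      if "- a \<le> j" "j + b \<le> a" "t \<in> {0..b}" "g (m + j + t) = c" for j t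
      using assms(1)[of "j + t"] that W by (simp add: add.assoc)
    ultimately show ?thesis using that(2) unfolding avail_def blocked_def by metis
  qed
  then show ?thesis using assms(3) unfolding good_def by blast
qed

text \<open>Goodness depends on \<open>2 * W + 1\<close> consecutive values only. By the pigeonhole
  principle two words of this length agree; the stretch between them is repeated periodically, and a
  good layer of the periodic sequence, shifted by a multiple of the period, has a window that
  already occurs in \<open>g\<close>.\<close>

lemma good_in_bounded_window:
  fixes lo :: int
  assumes S: "\<And>a b. (a, b) \<in> S \<Longrightarrow> 0 \<le> a \<and> a \<le> W" and W: "0 \<le> W"
    and per: "\<And>g N. N > 0 \<Longrightarrow> (\<And>x. g (x + N) = g x) \<Longrightarrow> sign_seq g \<Longrightarrow> \<exists>m. good S g m"
  shows "\<exists>hi. \<forall>g. sign_seq g \<longrightarrow> (\<exists>m\<in>{lo..hi}. good S g m)"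
proof -
  define V where "V = nat (2 * W + 1)"
  have "\<exists>m\<in>{lo..lo + 2 ^ V}. good S g m" if pm: "sign_seq g" for g
  proof -
    define word where "word p = {i\<in>{..<V}. g (lo - W + of_nat p + of_nat i) = 1}" for p :: nat
    \<comment> \<open>Two equal words of length \<open>2 * W + 1\<close> allow a periodic continuation.\<close>
    have "\<not> inj_on word {..2 ^ V}"
    proof
      assume "inj_on word {..2 ^ V}"
      then have "card {..2 ^ V :: nat} \<le> card (Pow {..<V})"
        by (rule card_inj_on_le) (auto simp: word_def)
      then show False by (simp add: card_Pow)
    qed
    then obtain p q where pq: "p < q" "q \<le> 2 ^ V" "word p = word q"
      unfolding inj_on_def by (metis atMost_iff linorder_neqE_nat)
    define N where "N = int q - int p"
    have N: "N > 0" using pq by (simp add: N_def)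
    define F where "F y = g (lo - W + of_nat p + y)" for y
    have F_shift: "F (N + y) = F y" if "0 \<le> y" "y \<le> 2 * W" for y
    proof -
      have y: "nat y < V" "int (nat y) = y" using that by (simp_all add: V_def)
      have "g (lo - W + of_nat p + y) = 1 \<longleftrightarrow> g (lo - W + of_nat q + y) = 1"
      proof -
        have "nat y \<in> word p \<longleftrightarrow> nat y \<in> word q" by (simp only: pq(3))
        then show ?thesis using y(1) by (simp only: word_def mem_Collect_eq lessThan_iff y(2)) simp
      qed
      moreover have "F (N + y) = g (lo - W + of_nat q + y)"
        unfolding F_def N_def by (rule arg_cong[of _ _ g]) simp
      ultimately show ?thesis
        using sign_seqD[OF pm, of "lo - W + of_nat q + y"] sign_seqD[OF pm, of "lo - W + of_nat p + y"]
        unfolding F_def by auto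
    qed
    \<comment> \<open>The second of the equal words prolongs the agreement with the periodic
      sequence past one period, so a full window may start anywhere in the first period.\<close>
    have F_mod: "F y = F (y mod N)" if "0 \<le> y" "y \<le> 2 * W + N - 1" for y
      using that
    proof (induction "nat y" arbitrary: y rule: less_induct)
      case less
      show ?case
      proof (cases "y < N")
        case False
        then have "F y = F (y - N)" using F_shift[of "y - N"] less.prems by simp
        also have "\<dots> = F ((y - N) mod N)" using less.hyps[of "y - N"] less.prems N False by simp
        also have "(y - N) mod N = y mod N" by simp
        finally show ?thesis .
      qed (use less.prems in simp)
    qed
    define h where "h x = F (x mod N)" for x
    have "\<exists>m. good S h m"
      by (rule per[OF N]) (use sign_seqD[OF pm] in \<open>auto simp: h_def F_def sign_seq_def\<close>)
    then obtain m where m: "good S h m" ..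
    define r where "r = (m - W) mod N"
    have r: "0 \<le> r" "r < N" using N by (simp_all add: r_def)
    have "good S g (lo + of_nat p + r)"
    proof (rule good_local[OF _ S m])
      fix i assume i: "- W \<le> i" "i \<le> W"
      have "h (m + i) = F ((r + (W + i)) mod N)"
        unfolding h_def r_def by (simp add: mod_add_left_eq)
      also have "\<dots> = F (r + (W + i))" using F_mod[of "r + (W + i)"] r i by simp
      also have "\<dots> = g (lo + of_nat p + r + i)" by (simp add: F_def algebra_simps)
      finally show "h (m + i) = g (lo + of_nat p + r + i)" .
    qed
    moreover have "int q \<le> 2 ^ V" using pq(2) by (metis of_nat_le_iff of_nat_numeral of_nat_power)
    then have "lo + of_nat p + r \<le> lo + 2 ^ V" using r(2) unfolding N_def by linarith
    then have "lo + of_nat p + r \<in> {lo..lo + 2 ^ V}" using r(1) by simp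
    ultimately show ?thesis by blast
  qed
  then show ?thesis by blast
qed

section \<open>Cube embeddings and layered colourings\<close>

text \<open>Opposite edges of a square flip the same coordinate: both paths flip the same set of
  coordinates, \<open>y \<noteq> s\<close> makes it a two-element set, and \<open>q\<close>, being
  different from \<open>y\<close>, must be \<open>s\<close>.\<close>

lemma sym_diff_singletons_cancel:
  assumes "sym_diff (sym_diff X {y}) {s} = sym_diff (sym_diff X {q}) {r}" "y \<noteq> s" "y \<noteq> q"
  shows "s = q"
proof (rule ccontr)
  assume "s \<noteq> q"
  with assms(2,3) have "q \<in> sym_diff (sym_diff X {y}) {s} \<longleftrightarrow> q \<in> X"
    "y \<in> sym_diff (sym_diff X {y}) {s} \<longleftrightarrow> y \<notin> X" "s \<in> sym_diff (sym_diff X {y}) {s} \<longleftrightarrow> s \<notin> X"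
    by auto
  then show False using assms \<open>s \<noteq> q\<close> by auto
qed

text \<open>Each edge flips one coordinate. Injectivity keeps the images of squares nondegenerate,
  so parallel edges flip the same coordinate \<open>p i\<close>; inserting the elements of
  \<open>A\<close> one by one gives the formula.\<close>

lemma cube_embedding_sym_diff:
  assumes emb: "cube_embedding d n \<psi>"
  obtains p where "inj_on p {1..d}"
    and "\<And>A. A \<subseteq> {1..d} \<Longrightarrow> \<psi> A = sym_diff (\<psi> {}) (p ` A)"
proof -
  have inj: "inj_on \<psi> (Pow {1..d})"
    and adj: "\<And>A B. A \<subseteq> {1..d} \<Longrightarrow> B \<subseteq> {1..d} \<Longrightarrow> cube_adj A B \<Longrightarrow> cube_adj (\<psi> A) (\<psi> B)"
    using emb by (auto simp: cube_embedding_def cube_verts_def)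
  have dir: "\<exists>x. \<psi> (insert i A) = sym_diff (\<psi> A) {x}"
    if "A \<subseteq> {1..d}" "i \<in> {1..d}" "i \<notin> A" for A i
  proof -
    have "sym_diff A (insert i A) = {i}" using that by auto
    then have "cube_adj A (insert i A)" by (simp add: cube_adj_def)
    then have "cube_adj (\<psi> A) (\<psi> (insert i A))" using adj that by simp
    then obtain x where "sym_diff (\<psi> A) (\<psi> (insert i A)) = {x}"
      unfolding cube_adj_def by (rule card_1_singletonE)
    then have "\<psi> (insert i A) = sym_diff (\<psi> A) {x}" by auto
    then show ?thesis ..
  qed
  define p where "p i = (SOME x. \<psi> {i} = sym_diff (\<psi> {}) {x})" for i
  have p: "\<psi> {i} = sym_diff (\<psi> {}) {p i}" if "i \<in> {1..d}" for i
    unfolding p_def by (rule someI_ex) (use dir[of "{}" i] that in auto)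
  have step: "\<psi> (insert i A) = sym_diff (\<psi> A) {p i}"
    if "finite A" "A \<subseteq> {1..d}" "i \<in> {1..d}" "i \<notin> A" for A i
    using that
  proof (induction A arbitrary: i rule: finite_induct)
    case empty
    then show ?case using p by simp
  next
    case (insert j A)
    have ij: "i \<noteq> j" using insert.prems by auto
    have 1: "\<psi> (insert i A) = sym_diff (\<psi> A) {p i}" using insert by auto
    obtain y where 2: "\<psi> (insert j A) = sym_diff (\<psi> A) {y}" using dir[of A j] insert by auto
    obtain s where 3: "\<psi> (insert i (insert j A)) = sym_diff (\<psi> (insert j A)) {s}"
      using dir[of "insert j A" i] insert by auto
    obtain r where 4: "\<psi> (insert j (insert i A)) = sym_diff (\<psi> (insert i A)) {r}"
      using dir[of "insert i A" j] insert ij by auto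
    have "insert i A \<noteq> insert j A" "insert i (insert j A) \<noteq> A" using ij insert by auto
    then have 5: "\<psi> (insert i A) \<noteq> \<psi> (insert j A)" "\<psi> (insert i (insert j A)) \<noteq> \<psi> A"
      using inj insert.prems unfolding inj_on_def by (metis PowI insert_subset)+
    have "y \<noteq> p i" using 5(1) 1 2 by auto
    moreover have "y \<noteq> s"
    proof
      assume "y = s"
      then have "\<psi> (insert i (insert j A)) = \<psi> A" unfolding 3 2 by auto
      then show False using 5(2) by simp
    qed
    moreover have "sym_diff (sym_diff (\<psi> A) {y}) {s} = sym_diff (sym_diff (\<psi> A) {p i}) {r}"
      using 1 2 3 4 by (metis insert_commute)
    ultimately have "s = p i" using sym_diff_singletons_cancel by metis
    then show ?case using 3 by simp
  qed
  have pinj: "inj_on p {1..d}"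
  proof (rule inj_onI)
    fix i j assume ij: "i \<in> {1..d}" "j \<in> {1..d}" "p i = p j"
    then have "\<psi> {i} = \<psi> {j}" using p by simp
    then show "i = j" using inj ij unfolding inj_on_def by (metis PowI empty_subsetI insert_subset singleton_inject)
  qed
  have main: "\<psi> A = sym_diff (\<psi> {}) (p ` A)" if "finite A" "A \<subseteq> {1..d}" for A
    using that
  proof (induction A rule: finite_induct)
    case (insert j A)
    have "p j \<notin> p ` A" using pinj insert.hyps insert.prems
      by (simp add: inj_on_image_mem_iff)
    moreover have "\<psi> (insert j A) = sym_diff (\<psi> A) {p j}" using step insert.hyps insert.prems by simp
    moreover have "\<psi> A = sym_diff (\<psi> {}) (p ` A)" using insert.IH insert.prems by simp
    moreover have "sym_diff (sym_diff X Y) {x} = sym_diff X (insert x Y)" if "x \<notin> Y" for X Y and x :: nat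
      using that by blast
    ultimately show ?case by (simp only: image_insert)
  qed auto
  show ?thesis by (rule that[OF pinj main[OF finite_subset]]) auto
qed

lemma card_sym_diff:
  assumes "finite A" "finite B"
  shows "card (sym_diff A B) = card A + card B - 2 * card (A \<inter> B)"
proof -
  have "card (sym_diff A B) = card (A - B) + card (B - A)"
    using assms by (intro card_Un_disjoint) auto
  moreover have "card A = card (A - B) + card (A \<inter> B)" "card B = card (B - A) + card (A \<inter> B)"
    using assms by (metis Int_Diff_Un Int_Diff_disjoint add.commute card_Un_disjoint finite_Diff finite_Int,
      metis Int_Diff_Un Int_Diff_disjoint Int_commute add.commute card_Un_disjoint finite_Diff finite_Int)
  ultimately show ?thesis by simp
qed

text \<open>The Ramsey property is applied to the colouring of a set by \<open>f\<close> of its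
  size. With \<open>X\<close> the image of the empty set and \<open>Q\<close> the directions that
  \<open>p\<close> sends into \<open>X\<close>, the image of \<open>A\<close> has size
  \<open>card X + card A - 2 * card (A \<inter> Q)\<close>.\<close>

lemma cube_ramsey_layer_coloring:
  fixes f :: "nat \<Rightarrow> bool"
  assumes ram: "cube_ramsey 2 d F" and F: "F \<subseteq> cube_verts d"
  obtains m Q c where "Q \<subseteq> {1..d}" "card Q \<le> m"
    "\<forall>A\<in>F. f (m + card A - 2 * card (A \<inter> Q)) = c"
proof -
  obtain n where n: "\<forall>c \<in> cube_verts n \<rightarrow> {1..2::nat}.
        \<exists>i\<in>{1..2}. contains_copy d n F {A \<in> cube_verts n. c A = i}"
    using ram unfolding cube_ramsey_def by blast
  define \<chi> where "\<chi> A = (if f (card A) then 1 else 2 :: nat)" for A :: "nat set"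
  have "\<chi> \<in> cube_verts n \<rightarrow> {1..2}" by (auto simp: \<chi>_def)
  then obtain i \<psi> where emb: "cube_embedding d n \<psi>" and im: "\<psi> ` F \<subseteq> {A \<in> cube_verts n. \<chi> A = i}"
    using n unfolding contains_copy_def by meson
  obtain p where pinj: "inj_on p {1..d}"
    and p: "\<And>A. A \<subseteq> {1..d} \<Longrightarrow> \<psi> A = sym_diff (\<psi> {}) (p ` A)"
    using cube_embedding_sym_diff[OF emb] by blast
  define X where "X = \<psi> {}"
  have X: "finite X" using emb unfolding X_def cube_embedding_def cube_verts_def
    by (metis Pi_mem PowD PowI empty_subsetI finite_atLeastAtMost finite_subset)
  define Q where "Q = {i\<in>{1..d}. p i \<in> X}"
  have "card Q = card (p ` Q)" by (intro card_image[symmetric] inj_on_subset[OF pinj]) (auto simp: Q_def)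
  also have "\<dots> \<le> card X" by (intro card_mono X) (auto simp: Q_def)
  finally have "card Q \<le> card X" .
  moreover have "\<forall>A\<in>F. f (card X + card A - 2 * card (A \<inter> Q)) = (i = 1)"
  proof
    fix A assume "A \<in> F"
    have A: "A \<subseteq> {1..d}" "finite A" using F \<open>A \<in> F\<close> by (auto simp: cube_verts_def intro: finite_subset)
    then have "inj_on p A" using pinj inj_on_subset by blast
    have "X \<inter> p ` A = p ` (A \<inter> Q)" using A by (auto simp: Q_def)
    moreover have "card (p ` (A \<inter> Q)) = card (A \<inter> Q)" "card (p ` A) = card A"
      using \<open>inj_on p A\<close> by (auto intro!: card_image intro: inj_on_subset)
    ultimately have "card (\<psi> A) = card X + card A - 2 * card (A \<inter> Q)"
      using p[OF A(1)] card_sym_diff[OF X, of "p ` A"] A by (simp add: X_def)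
    moreover have "\<chi> (\<psi> A) = i" using im \<open>A \<in> F\<close> by auto
    ultimately show "f (card X + card A - 2 * card (A \<inter> Q)) = (i = 1)"
      by (auto simp: \<chi>_def split: if_splits)
  qed
  moreover have "Q \<subseteq> {1..d}" by (auto simp: Q_def)
  ultimately show ?thesis using that by metis
qed

section \<open>Ramsey's theorem and the reduction to layered colourings\<close>

lemma ramsey_two_coloring:
  "\<exists>N. \<forall>Y (\<chi> :: nat set \<Rightarrow> bool). finite Y \<longrightarrow> N \<le> card Y \<longrightarrow>
     (\<exists>X\<subseteq>Y. card X = l \<and> (\<exists>b. \<forall>A\<in>nsets X r. \<chi> A = b))"
proof -
  obtain N :: nat where N: "partn_lst {..<N} [l, l] r" using ramsey_full by blast
  have "\<exists>X\<subseteq>Y. card X = l \<and> (\<exists>b. \<forall>A\<in>nsets X r. \<chi> A = b)"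
    if Y: "finite Y" "N \<le> card Y" for Y and \<chi> :: "nat set \<Rightarrow> bool"
  proof -
    obtain Z where Z: "Z \<subseteq> Y" "card Z = N" "finite Z"
      using obtain_subset_with_card_n[OF Y(2)] by blast
    then obtain h where h: "bij_betw h {..<N} Z"
      using ex_bij_betw_nat_finite[of Z] by (auto simp: atLeast0LessThan)
    define f where "f A = (if \<chi> (h ` A) then 0 else 1 :: nat)" for A
    have "f \<in> nsets {..<N} r \<rightarrow> {..<length [l, l]}" by (auto simp: f_def)
    with N have "\<exists>i<length [l, l]. monochromatic {..<N} ([l, l] ! i) r f i"
      unfolding partn_lst_def by (rule bspec)
    then obtain i where i: "i < 2" "monochromatic {..<N} ([l, l] ! i) r f i"
      by (auto simp: numeral_2_eq_2)
    have "[l, l] ! i = l" using less_2_cases[OF i(1)] by auto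
    then obtain H where H: "H \<in> nsets {..<N} l" "f ` nsets H r \<subseteq> {i}"
      using i(2) unfolding monochromatic_def by auto
    have H': "H \<subseteq> {..<N}" "finite H" "card H = l" using H(1) by (auto simp: nsets_def)
    have injH: "inj_on h H" using h H'(1) by (meson bij_betw_def inj_on_subset)
    have "\<chi> A = (i = 0)" if A: "A \<in> nsets (h ` H) r" for A
    proof -
      obtain B where B: "B \<in> nsets H r" "A = h ` B"
        by (rule nset_image_obtains[OF A injH])
      then have "f B = i" using H(2) by blast
      then show ?thesis unfolding f_def B(2) by (simp split: if_splits)
    qed
    moreover have "h ` H \<subseteq> Y" using h H'(1) Z(1) by (auto simp: bij_betw_def)
    moreover have "card (h ` H) = l" using injH H'(3) by (simp add: card_image)
    ultimately show ?thesis by blast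
  qed
  then show ?thesis by blast
qed

text \<open>Sizes are treated one after another: homogeneity for the sizes below \<open>r\<close>
  passes to subsets, so the set for \<open>Suc r\<close> is found inside one for
  \<open>r\<close>.\<close>

lemma ramsey_layers:
  "\<exists>N. \<forall>Y (\<chi> :: nat set \<Rightarrow> bool). finite Y \<longrightarrow> N \<le> card Y \<longrightarrow>
     (\<exists>X\<subseteq>Y. card X = l \<and> (\<forall>s<r. \<exists>b. \<forall>A\<in>nsets X s. \<chi> A = b))"
proof (induction r arbitrary: l)
  case 0
  have "\<forall>Y (\<chi> :: nat set \<Rightarrow> bool). finite Y \<longrightarrow> l \<le> card Y \<longrightarrow> (\<exists>X\<subseteq>Y. card X = l)"
    by (metis obtain_subset_with_card_n)
  then show ?case by auto
next
  case (Suc r)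
  from ramsey_two_coloring[of l r]
  obtain N where N: "\<forall>Y (\<chi> :: nat set \<Rightarrow> bool). finite Y \<longrightarrow> N \<le> card Y \<longrightarrow>
     (\<exists>X\<subseteq>Y. card X = l \<and> (\<exists>b. \<forall>A\<in>nsets X r. \<chi> A = b))" ..
  from Suc.IH[of N]
  obtain N' where N': "\<forall>Y (\<chi> :: nat set \<Rightarrow> bool). finite Y \<longrightarrow> N' \<le> card Y \<longrightarrow>
     (\<exists>X\<subseteq>Y. card X = N \<and> (\<forall>s<r. \<exists>b. \<forall>A\<in>nsets X s. \<chi> A = b))" ..
  have "\<exists>X\<subseteq>Y. card X = l \<and> (\<forall>s<Suc r. \<exists>b. \<forall>A\<in>nsets X s. \<chi> A = b)"
    if Y: "finite Y" "N' \<le> card Y" for Y and \<chi> :: "nat set \<Rightarrow> bool"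
  proof -
    obtain Z where Z: "Z \<subseteq> Y" "card Z = N" "\<forall>s<r. \<exists>b. \<forall>A\<in>nsets Z s. \<chi> A = b"
      using N' Y by blast
    then have "finite Z" using Y finite_subset by blast
    then obtain X where X: "X \<subseteq> Z" "card X = l" "\<exists>b. \<forall>A\<in>nsets X r. \<chi> A = b"
      using N Z(2) by (metis le_refl)
    have "\<exists>b. \<forall>A\<in>nsets X s. \<chi> A = b" if "s < Suc r" for s
    proof (cases "s = r")
      case False
      then show ?thesis using that Z(3) nsets_mono[OF X(1), of s] by (meson less_SucE subsetD)
    qed (use X in simp)
    then show ?thesis using X Z by blast
  qed
  then show ?case by blast
qed

text \<open>In a set \<open>X\<close> where colours depend on size alone, \<open>d\<close> points
  form \<open>P\<close> and carry the cube, and at most \<open>l\<close> further points form the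
  padding \<open>R\<close>. The map taking \<open>A\<close> to \<open>p\<close> applied to
  \<open>sym_diff A Q\<close>, together with \<open>R\<close>, sends the empty set to a set of size
  \<open>m\<close>; \<open>d \<le> m\<close> keeps the natural subtractions exact.\<close>

lemma cube_ramsey_if_layer_colorings:
  assumes F: "F \<subseteq> cube_verts d"
    and layers: "\<And>f :: nat \<Rightarrow> bool. \<exists>m Q c. d \<le> m \<and> m \<le> l \<and> Q \<subseteq> {1..d} \<and>
      (\<forall>A\<in>F. f (m + card A - 2 * card (A \<inter> Q)) = c)"
  shows "cube_ramsey 2 d F"
proof -
  from ramsey_layers[of "l + d" "Suc (l + d)"]
  obtain N where N: "\<forall>Y (\<chi> :: nat set \<Rightarrow> bool). finite Y \<longrightarrow> N \<le> card Y \<longrightarrow>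
     (\<exists>X\<subseteq>Y. card X = l + d \<and> (\<forall>s<Suc (l + d). \<exists>b. \<forall>A\<in>nsets X s. \<chi> A = b))" ..
  have "\<exists>i\<in>{1..2}. contains_copy d n F {A \<in> cube_verts n. \<chi> A = i}"
    if n: "N \<le> n" and \<chi>: "\<chi> \<in> cube_verts n \<rightarrow> {1..2::nat}" for n \<chi>
  proof -
    obtain X where X: "X \<subseteq> {1..n}" "card X = l + d"
      and hom: "\<forall>s<Suc (l + d). \<exists>b. \<forall>A\<in>nsets X s. (\<chi> A = 1) = b"
      using N[rule_format, of "{1..n}" "\<lambda>A. \<chi> A = 1"] n by auto
    have finX: "finite X" using X(1) finite_subset by blast
    obtain f where f: "\<And>s A. s < Suc (l + d) \<Longrightarrow> A \<in> nsets X s \<Longrightarrow> (\<chi> A = 1) = f s"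
      using hom by metis
    obtain m Q c where m: "d \<le> m" "m \<le> l" and Q: "Q \<subseteq> {1..d}"
      and c: "\<And>A. A \<in> F \<Longrightarrow> f (m + card A - 2 * card (A \<inter> Q)) = c"
      using layers[of f] by blast
    obtain P where P: "P \<subseteq> X" "card P = d"
      using obtain_subset_with_card_n[of d X] X(2) by auto
    have finP: "finite P" using P finX finite_subset by blast
    obtain p where p: "bij_betw p {1..d} P"
      using finite_same_card_bij[of "{1..d}" P] P finP by auto
    have pinj: "inj_on p {1..d}" and pim: "p ` {1..d} = P" using p by (auto simp: bij_betw_def)
    have "card (X - P) = l" using P X finP by (simp add: card_Diff_subset)
    then have "m - card Q \<le> card (X - P)" using m by simp
    then obtain R where R: "R \<subseteq> X - P" "card R = m - card Q"
      by (rule obtain_subset_with_card_n)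
    have finR: "finite R" using R finX finite_subset by blast
    define \<psi> where "\<psi> A = p ` sym_diff A Q \<union> R" for A
    have sub: "sym_diff A Q \<subseteq> {1..d}" if "A \<subseteq> {1..d}" for A using that Q by auto
    have inP: "p ` sym_diff A Q \<subseteq> P" if "A \<subseteq> {1..d}" for A using sub[OF that] pim by blast
    have \<psi>X: "\<psi> A \<subseteq> X" if "A \<subseteq> {1..d}" for A using inP[OF that] P(1) R(1) by (auto simp: \<psi>_def)
    have img: "p ` sym_diff U V = sym_diff (p ` U) (p ` V)"
      if "U \<subseteq> {1..d}" "V \<subseteq> {1..d}" for U V
    proof -
      have "U - V \<subseteq> {1..d}" "V - U \<subseteq> {1..d}" using that by auto
      then show ?thesis
        using that by (simp only: image_Un inj_on_image_set_diff[OF pinj])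
    qed
    have diff: "sym_diff (\<psi> A) (\<psi> B) = p ` sym_diff A B" if AB: "A \<subseteq> {1..d}" "B \<subseteq> {1..d}" for A B
    proof -
      have "sym_diff (\<psi> A) (\<psi> B) = sym_diff (p ` sym_diff A Q) (p ` sym_diff B Q)"
        using inP[OF AB(1)] inP[OF AB(2)] R(1) unfolding \<psi>_def by blast
      also have "\<dots> = p ` sym_diff (sym_diff A Q) (sym_diff B Q)"
        by (rule img[OF sub[OF AB(1)] sub[OF AB(2)], symmetric])
      also have "sym_diff (sym_diff A Q) (sym_diff B Q) = sym_diff A B" by blast
      finally show ?thesis .
    qed
    have "cube_embedding d n \<psi>"
      unfolding cube_embedding_def cube_verts_def
    proof (intro conjI ballI impI)
      show "\<psi> \<in> Pow {1..d} \<rightarrow> Pow {1..n}" using \<psi>X X(1) by blast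
      show "inj_on \<psi> (Pow {1..d})"
      proof (rule inj_onI)
        fix A B assume AB: "A \<in> Pow {1..d}" "B \<in> Pow {1..d}" "\<psi> A = \<psi> B"
        then have "p ` sym_diff A B = {}" using diff[of A B] by auto
        then have "sym_diff A B = {}" unfolding image_is_empty .
        then show "A = B" by auto
      qed
      show "cube_adj (\<psi> A) (\<psi> B)" if "A \<in> Pow {1..d}" "B \<in> Pow {1..d}" "cube_adj A B" for A B
      proof -
        have "card (p ` sym_diff A B) = card (sym_diff A B)"
          using that by (intro card_image inj_on_subset[OF pinj]) auto
        then show ?thesis using that diff[of A B] by (simp only: cube_adj_def Pow_iff)
      qed
    qed
    moreover have "\<psi> A \<in> {A \<in> cube_verts n. \<chi> A = (if c then 1 else 2)}" if "A \<in> F" for A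
    proof -
      have A: "A \<subseteq> {1..d}" using F that by (auto simp: cube_verts_def)
      have fin: "finite A" "finite Q" using A Q finite_subset by blast+
      have cQ: "card Q \<le> d" "card (A \<inter> Q) \<le> card Q" "card (A \<inter> Q) \<le> card A" "card A \<le> d"
        using card_mono[OF _ Q] card_mono[OF _ A] fin by (auto intro: card_mono)
      have "card (\<psi> A) = card (p ` sym_diff A Q) + card R"
        unfolding \<psi>_def using finP finR inP[OF A] R(1)
        by (intro card_Un_disjoint) (auto intro: finite_subset)
      also have "card (p ` sym_diff A Q) = card A + card Q - 2 * card (A \<inter> Q)"
        using card_image[OF inj_on_subset[OF pinj sub[OF A]]] card_sym_diff[OF fin] by simp
      finally have card: "card (\<psi> A) = m + card A - 2 * card (A \<inter> Q)"
        using R(2) m cQ by simp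
      have "card (\<psi> A) < Suc (l + d)" using card m cQ by simp
      moreover have "\<psi> A \<in> nsets X (card (\<psi> A))"
        using \<psi>X[OF A] finX by (auto simp: nsets_def intro: finite_subset)
      ultimately have "(\<chi> (\<psi> A) = 1) = c" using f c[OF that] card by metis
      moreover have "\<psi> A \<in> cube_verts n" using \<psi>X[OF A] X(1) by (auto simp: cube_verts_def)
      moreover from this have "\<chi> (\<psi> A) \<in> {1..2}" using \<chi> by blast
      ultimately show ?thesis by auto
    qed
    ultimately have "contains_copy d n F {A \<in> cube_verts n. \<chi> A = (if c then 1 else 2)}"
      unfolding contains_copy_def by blast
    then show ?thesis by (intro bexI[of _ "if c then 1 else 2"]) auto
  qed
  then show ?thesis unfolding cube_ramsey_def by blast
qed

section \<open>Cliques in layered colourings\<close>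

definition color_sign :: "bool \<Rightarrow> int" where
  "color_sign c = (if c then 1 else - 1)"

lemma color_sign_eq_iff: "color_sign c = color_sign c' \<longleftrightarrow> c = c'"
  by (simp add: color_sign_def)

lemma sign_seq_color_sign: "sign_seq (\<lambda>x. color_sign (f x))"
  by (simp add: sign_seq_def color_sign_def)

lemma color_sign_cases: "s \<in> {1, -1} \<Longrightarrow> \<exists>c. s = color_sign c"
  by (auto simp: color_sign_def intro: exI[of _ True] exI[of _ False])

text \<open>Layers are counted in units of two from the even base \<open>2 * m\<close>. The extreme
  positions come from \<open>Q = {}\<close> and \<open>Q = K\<close>. With
  \<open>card Q = A - j\<close>, the intersections \<open>S \<inter> Q\<close> are smaller than
  \<open>Q\<close> by at most \<open>card K - a\<close>, so the clique occupies layers from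
  \<open>m + j\<close> to \<open>m + j + (card K - a)\<close>.\<close>

lemma clique_shift_if_avail:
  assumes K: "finite K" "a \<le> card K" and a: "int a = 2 * A" and m: "A \<le> m"
    and av: "avail (\<lambda>y. color_sign (f (nat (2 * y)))) A (int (card K - a)) m (color_sign c)"
  shows "\<exists>Q\<subseteq>K. \<forall>S\<in>nsets K a. f (nat (2 * m) + card S - 2 * card (S \<inter> Q)) = c"
proof -
  have S: "finite S" "card S = a" "S \<subseteq> K" if "S \<in> nsets K a" for S
    using that by (auto simp: nsets_def)
  have weight: "nat (2 * (m + A - int s)) = nat (2 * m) + a - 2 * s" for s
  proof -
    have "2 * (m + A - int s) = int (nat (2 * m) + a) - int (2 * s)" using a m by simp
    then show ?thesis by (simp only: nat_minus_as_int)
  qed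
  have shift: ?thesis
    if "Q \<subseteq> K" "\<And>S. S \<in> nsets K a \<Longrightarrow> f (nat (2 * (m + A - int (card (S \<inter> Q))))) = c" for Q
    using that S weight by auto
  from av consider "f (nat (2 * (m + A))) = c" | "f (nat (2 * (m - A))) = c"
    | j where "- A \<le> j" "j + int (card K - a) \<le> A"
        "\<And>t. t \<in> {0..int (card K - a)} \<Longrightarrow> f (nat (2 * (m + j + t))) = c"
    unfolding avail_def blocked_def color_sign_eq_iff by blast
  then show ?thesis
  proof cases
    case 1
    then show ?thesis by (intro shift[of "{}"]) simp_all
  next
    case 2
    show ?thesis
    proof (rule shift[of K])
      fix T assume "T \<in> nsets K a"
      then have "T \<inter> K = T" "card T = a" using S by auto
      then have "m + A - int (card (T \<inter> K)) = m - A" using a by simp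
      then show "f (nat (2 * (m + A - int (card (T \<inter> K))))) = c" using 2 by simp
    qed simp
  next
    case 3
    define q where "q = nat (A - j)"
    have q: "int q = A - j" using 3(2) by (simp add: q_def)
    then have "q \<le> card K" using 3(1) a K(2) by linarith
    then obtain Q where Q: "Q \<subseteq> K" "card Q = q" "finite Q" by (rule obtain_subset_with_card_n)
    show ?thesis
    proof (rule shift[OF Q(1)])
      fix T assume T: "T \<in> nsets K a"
      have "card (T \<union> Q) \<le> card K" using S(3)[OF T] Q(1) K(1) by (intro card_mono) auto
      then have "a + q \<le> card K + card (T \<inter> Q)"
        using card_Un_Int[of T Q] S[OF T] Q by simp
      moreover have "card (T \<inter> Q) \<le> q" using Q card_mono[of Q "T \<inter> Q"] by auto
      ultimately have "int q - int (card (T \<inter> Q)) \<in> {0..int (card K - a)}" using K(2) by auto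
      moreover have "m + j + (int q - int (card (T \<inter> Q))) = m + A - int (card (T \<inter> Q))" using q by simp
      ultimately show "f (nat (2 * (m + A - int (card (T \<inter> Q))))) = c" using 3(3) by metis
    qed
  qed
qed

text \<open>The counterpart in units of a single layer, applied to odd weights, which cannot be
  halved; only \<open>Q = {}\<close> and \<open>Q = K\<close> are used.\<close>

lemma clique_shift_if_unblocked:
  assumes K: "finite K" "a \<le> card K" and m: "int a \<le> m"
    and av: "\<not> blocked (\<lambda>y. color_sign (f (nat y))) (int a) m (color_sign c)"
  shows "\<exists>Q\<subseteq>K. \<forall>S\<in>nsets K a. f (nat m + card S - 2 * card (S \<inter> Q)) = c"
proof -
  have S: "card S = a" "S \<inter> K = S" if "S \<in> nsets K a" for S
    using that by (auto simp: nsets_def)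
  from av consider "f (nat (m + int a)) = c" | "f (nat (m - int a)) = c"
    unfolding blocked_def color_sign_eq_iff by blast
  then show ?thesis
  proof cases
    case 1
    moreover have "nat m + a = nat (m + int a)" using m by simp
    ultimately show ?thesis using S by (intro exI[of _ "{}"]) simp
  next
    case 2
    moreover have "nat m + a - 2 * a = nat (m - int a)" using m by simp
    ultimately show ?thesis using S by (intro exI[of _ K]) simp
  qed
qed

lemma disjoint_cliques_shift:
  assumes Q: "\<exists>Q\<subseteq>K1. \<forall>S\<in>nsets K1 a1. f (m + card S - 2 * card (S \<inter> Q)) = c"
      "\<exists>Q\<subseteq>K2. \<forall>S\<in>nsets K2 a2. f (m + card S - 2 * card (S \<inter> Q)) = c"
      "\<exists>Q\<subseteq>K3. \<forall>S\<in>nsets K3 a3. f (m + card S - 2 * card (S \<inter> Q)) = c"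
    and disj: "K1 \<inter> K2 = {}" "K1 \<inter> K3 = {}" "K2 \<inter> K3 = {}"
  shows "\<exists>Q\<subseteq>K1 \<union> K2 \<union> K3. \<forall>S\<in>nsets K1 a1 \<union> nsets K2 a2 \<union> nsets K3 a3.
    f (m + card S - 2 * card (S \<inter> Q)) = c"
proof -
  obtain Q1 where Q1: "Q1 \<subseteq> K1" "\<forall>S\<in>nsets K1 a1. f (m + card S - 2 * card (S \<inter> Q1)) = c"
    using Q(1) by (elim exE conjE)
  obtain Q2 where Q2: "Q2 \<subseteq> K2" "\<forall>S\<in>nsets K2 a2. f (m + card S - 2 * card (S \<inter> Q2)) = c"
    using Q(2) by (elim exE conjE)
  obtain Q3 where Q3: "Q3 \<subseteq> K3" "\<forall>S\<in>nsets K3 a3. f (m + card S - 2 * card (S \<inter> Q3)) = c"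
    using Q(3) by (elim exE conjE)
  note sub = Q1(1) Q2(1) Q3(1)
  have "f (m + card S - 2 * card (S \<inter> (Q1 \<union> Q2 \<union> Q3))) = c"
    if S: "S \<in> nsets K1 a1 \<union> nsets K2 a2 \<union> nsets K3 a3" for S
  proof -
    have sets: "S \<subseteq> K1 \<Longrightarrow> S \<inter> (Q1 \<union> Q2 \<union> Q3) = S \<inter> Q1"
      "S \<subseteq> K2 \<Longrightarrow> S \<inter> (Q1 \<union> Q2 \<union> Q3) = S \<inter> Q2"
      "S \<subseteq> K3 \<Longrightarrow> S \<inter> (Q1 \<union> Q2 \<union> Q3) = S \<inter> Q3"
      using sub disj by blast+
    consider "S \<in> nsets K1 a1" | "S \<in> nsets K2 a2" | "S \<in> nsets K3 a3" using S by blast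
    then show ?thesis
    proof cases
      case 1
      then have "S \<subseteq> K1" by (simp add: nsets_def)
      then show ?thesis using bspec[OF Q1(2) 1] sets(1) by simp
    next
      case 2
      then have "S \<subseteq> K2" by (simp add: nsets_def)
      then show ?thesis using bspec[OF Q2(2) 2] sets(2) by simp
    next
      case 3
      then have "S \<subseteq> K3" by (simp add: nsets_def)
      then show ?thesis using bspec[OF Q3(2) 3] sets(3) by simp
    qed
  qed
  moreover have "Q1 \<union> Q2 \<union> Q3 \<subseteq> K1 \<union> K2 \<union> K3" using sub by blast
  ultimately show ?thesis by (intro exI[of _ "Q1 \<union> Q2 \<union> Q3"]) simp
qed

section \<open>Colourings that separate two cliques\<close>

lemma card_nsets_Int_values:
  assumes K: "finite K" "a \<le> card K" and j: "j \<le> a" "j \<le> card (Q \<inter> K)" "a + card (Q \<inter> K) \<le> card K + j"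
  shows "\<exists>S\<in>nsets K a. card (S \<inter> Q) = j"
proof -
  have fin: "finite (Q \<inter> K)" "finite (K - Q)" using K(1) by auto
  obtain U where U: "U \<subseteq> Q \<inter> K" "card U = j" "finite U"
    using obtain_subset_with_card_n[OF j(2)] by blast
  have "card K = card (Q \<inter> K) + card (K - Q)"
    by (subst card_Un_disjoint[symmetric]) (use fin in \<open>auto intro!: arg_cong[of _ _ card]\<close>)
  then have "a - j \<le> card (K - Q)" using j by simp
  then obtain V where V: "V \<subseteq> K - Q" "card V = a - j" "finite V"
    using obtain_subset_with_card_n by blast
  have "card (U \<union> V) = a" using U V j(1) by (subst card_Un_disjoint) auto
  moreover have "(U \<union> V) \<inter> Q = U" using U V by auto
  moreover have "U \<union> V \<subseteq> K" using U V by auto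
  ultimately show ?thesis using U V by (intro bexI[of _ "U \<union> V"]) (auto simp: nsets_def)
qed

text \<open>The sizes of \<open>S \<inter> Q\<close> form an interval. If it contains
  \<open>0\<close> or \<open>a\<close>, an extreme layer has colour \<open>c\<close>; otherwise the
  clique fills \<open>card K - a + 1\<close> consecutive layers in units of two, a monochromatic run
  that \<open>runs\<close> excludes.\<close>

lemma monochromatic_clique_extreme:
  fixes A :: int
  assumes K: "finite K" "a \<le> card K" and a: "int a = 2 * A" and Q: "finite Q" "card Q \<le> m"
    and mono: "\<And>S. S \<in> nsets K a \<Longrightarrow> G (int (m + card S - 2 * card (S \<inter> Q)) div 2) = (c :: bool)"
    and runs: "A = 0 \<or> (\<forall>x. \<exists>t. 0 \<le> t \<and> t \<le> int (card K - a) \<and> G (x + t) \<noteq> G x)"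
  shows "G (int m div 2 + A) = c \<or> G (int m div 2 - A) = c"
proof -
  define q where "q = card (Q \<inter> K)"
  have q: "q \<le> card Q" "q \<le> card K" using K Q by (auto simp: q_def intro: card_mono)
  have layer: "G (int m div 2 + A - int s) = c" if s: "s \<le> a" "s \<le> q" "a + q \<le> card K + s" for s
  proof -
    obtain S where S: "S \<in> nsets K a" "card (S \<inter> Q) = s"
      using card_nsets_Int_values[OF K, of s Q] s unfolding q_def by blast
    have "card S = a" using S(1) by (simp add: nsets_def)
    moreover have "2 * s \<le> m + a" using s q Q(2) by simp
    ultimately have "int (m + card S - 2 * card (S \<inter> Q)) = int m + (A - int s) * 2"
      using S(2) a by (simp add: of_nat_diff)
    moreover have "(int m + (A - int s) * 2) div 2 = (A - int s) + int m div 2"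
      by (rule div_mult_self1) simp
    ultimately have "G ((A - int s) + int m div 2) = c" using mono[OF S(1)] by metis
    then show ?thesis by (simp add: algebra_simps)
  qed
  consider "q \<le> card K - a" | "a \<le> q" | "card K - a < q" "q < a" by linarith
  then show ?thesis
  proof cases
    case 1
    then show ?thesis using layer[of 0] K(2) by simp
  next
    case 2
    then show ?thesis using layer[of a] q(2) a by simp
  next
    case 3
    then have "A \<noteq> 0" using a by auto
    then obtain t where t: "0 \<le> t" "t \<le> int (card K - a)"
      "G (int m div 2 + A - int q + t) \<noteq> G (int m div 2 + A - int q)"
      using runs by blast
    have "nat t \<le> card K - a" using t by simp
    then have "q - nat t \<le> a" "q - nat t \<le> q" "a + q \<le> card K + (q - nat t)" "int (q - nat t) = int q - t"
      using t(1) 3 K(2) by simp_all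
    then have "G (int m div 2 + A - (int q - t)) = c" using layer[of "q - nat t"] by simp
    moreover have "int m div 2 + A - (int q - t) = int m div 2 + A - int q + t" by simp
    moreover have "G (int m div 2 + A - int q) = c" using layer[of q] 3 K(2) by simp
    ultimately show ?thesis using t(3) by metis
  qed
qed

text \<open>Sets of size \<open>w\<close> are coloured by \<open>G (w div 2)\<close>. Both cliques
  must use an extreme layer, at distance \<open>k1 * D\<close> or \<open>k2 * D\<close> from the
  same base layer; as \<open>k1\<close> and \<open>k2\<close> differ in parity, antiperiodicity
  gives these layers opposite colours.\<close>

lemma antiperiodic_coloring_not_ramsey:
  fixes A1 A2 D :: int
  assumes K: "K1 \<subseteq> {1..d}" "K2 \<subseteq> {1..d}" "a1 \<le> card K1" "a2 \<le> card K2"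
    and a: "int a1 = 2 * A1" "int a2 = 2 * A2"
    and anti: "\<And>x. G (x + D) = (\<not> G x)" and D: "A1 = k1 * D" "A2 = k2 * D" "odd (k1 + k2)"
    and runs: "A1 = 0 \<or> (\<forall>x. \<exists>t. 0 \<le> t \<and> t \<le> int (card K1 - a1) \<and> G (x + t) \<noteq> G x)"
      "A2 = 0 \<or> (\<forall>x. \<exists>t. 0 \<le> t \<and> t \<le> int (card K2 - a2) \<and> G (x + t) \<noteq> G x)"
  shows "\<not> cube_ramsey 2 d (nsets K1 a1 \<union> nsets K2 a2)"
proof
  assume ram: "cube_ramsey 2 d (nsets K1 a1 \<union> nsets K2 a2)"
  have sub: "nsets K1 a1 \<union> nsets K2 a2 \<subseteq> cube_verts d"
    using K(1,2) by (auto simp: nsets_def cube_verts_def)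
  obtain m Q c where Q: "Q \<subseteq> {1..d}" "card Q \<le> m"
    and mono': "\<forall>S\<in>nsets K1 a1 \<union> nsets K2 a2.
      G (int (m + card S - 2 * card (S \<inter> Q)) div 2) = c"
    by (rule cube_ramsey_layer_coloring[OF ram sub, of "\<lambda>w. G (int w div 2)"])
  note mono = bspec[OF mono']
  have fin: "finite K1" "finite K2" "finite Q" using K Q by (auto intro: finite_subset)
  define y where "y = int m div 2"
  define h where "h x = color_sign (G x)" for x
  have h: "h (x + D) = - h x" for x using anti[of x] by (simp add: h_def color_sign_def)
  have h0: "h x \<noteq> 0" for x by (simp add: h_def color_sign_def)
  have "G (y + A1) = c \<or> G (y - A1) = c"
    unfolding y_def by (rule monochromatic_clique_extreme[OF fin(1) K(3) a(1) fin(3) Q(2) mono runs(1)]) simp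
  then have "h (y + k1 * D) = color_sign c \<or> h (y + (- k1) * D) = color_sign c"
    using D(1) by (auto simp: h_def)
  then have 1: "color_sign c = (if even k1 then h y else - h y)"
    unfolding antiperiodic_mult[of h, OF h] by auto
  have "G (y + A2) = c \<or> G (y - A2) = c"
    unfolding y_def by (rule monochromatic_clique_extreme[OF fin(2) K(4) a(2) fin(3) Q(2) mono runs(2)]) simp
  then have "h (y + k2 * D) = color_sign c \<or> h (y + (- k2) * D) = color_sign c"
    using D(2) by (auto simp: h_def)
  then have 2: "color_sign c = (if even k2 then h y else - h y)"
    unfolding antiperiodic_mult[of h, OF h] by auto
  show False using 1 2 D(3) h0[of y] by (auto split: if_splits)
qed

lemma div_add_one:
  fixes x D :: int
  assumes "D > 0"
  shows "(x + 1) div D = (if D dvd x + 1 then x div D + 1 else x div D)"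
proof -
  have x: "x = D * (x div D) + x mod D" "0 \<le> x mod D" "x mod D < D" using assms by simp_all
  show ?thesis
  proof (cases "x mod D + 1 = D")
    case True
    then have "x + 1 = D * (x div D) + D" using x(1) by linarith
    then have "x + 1 = D * (x div D + 1)" by (simp only: distrib_left mult_1_right)
    then show ?thesis using assms by simp
  next
    case False
    then have r: "x + 1 = D * (x div D) + (x mod D + 1)" "0 \<le> x mod D + 1" "x mod D + 1 < D"
      using x by linarith+
    then have "(x + 1) div D = x div D" "(x + 1) mod D = x mod D + 1"
      using int_div_pos_eq[OF r] int_mod_pos_eq[OF r] by simp_all
    then show ?thesis using x(2) by (simp add: dvd_eq_mod_eq_0)
  qed
qed

text \<open>For odd \<open>D\<close> the colouring by parity is antiperiodic without monochromatic runs of two;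
  for even \<open>D\<close>, alternating colours with a repetition at each multiple of \<open>D\<close> has no
  monochromatic runs of three.\<close>

lemma pair_ok_if_ramsey:
  assumes ram: "cube_ramsey 2 d (nsets K1 a1 \<union> nsets K2 a2)"
    and K: "K1 \<subseteq> {1..d}" "K2 \<subseteq> {1..d}" "a1 \<le> card K1" "a2 \<le> card K2"
    and a: "int a1 = 2 * A1" "int a2 = 2 * A2" and ne: "A1 \<noteq> A2"
  shows "pair_ok A1 (int (card K1 - a1)) A2 (int (card K2 - a2))"
proof (rule ccontr)
  assume "\<not> ?thesis"
  then have nsame: "\<not> same_val A1 A2"
    and b: "A1 > 0 \<Longrightarrow> 1 \<le> card K1 - a1" "A2 > 0 \<Longrightarrow> 1 \<le> card K2 - a2"
    and b': "even A1 \<Longrightarrow> even A2 \<Longrightarrow> A1 > 0 \<Longrightarrow> 2 \<le> card K1 - a1"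
      "even A1 \<Longrightarrow> even A2 \<Longrightarrow> A2 > 0 \<Longrightarrow> 2 \<le> card K2 - a2"
    unfolding pair_ok_def by auto
  have nonneg: "A1 \<ge> 0" "A2 \<ge> 0" using a by simp_all
  define D where "D = gcd A1 A2"
  define k1 k2 where "k1 = A1 div D" and "k2 = A2 div D"
  have D: "D > 0" "A1 = k1 * D" "A2 = k2 * D"
    using ne by (auto simp: D_def k1_def k2_def)
  have "coprime k1 k2" unfolding k1_def k2_def D_def using ne by (intro div_gcd_coprime) auto
  then have "odd k1 \<or> odd k2" by (metis coprime_common_divisor odd_one)
  moreover have "k2 * A1 = k1 * A2" using D by simp
  \<comment> \<open>If \<open>k1\<close> and \<open>k2\<close> were both odd, \<open>A1\<close> and
    \<open>A2\<close> would have the same valuation.\<close>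
  ultimately have odd: "odd (k1 + k2)" using nsame unfolding same_val_def by auto
  show False
  proof (cases "even D")
    case False
    have step: "\<forall>x :: int. \<exists>t. 0 \<le> t \<and> t \<le> b \<and> odd (x + t) \<noteq> odd x" if "1 \<le> b" for b
      using that by (intro allI exI[of _ 1]) simp
    have "A1 = 0 \<or> (\<forall>x :: int. \<exists>t. 0 \<le> t \<and> t \<le> int (card K1 - a1) \<and> odd (x + t) \<noteq> odd x)"
    proof (cases "A1 = 0")
      case False
      then have "1 \<le> int (card K1 - a1)" using b(1) nonneg(1) by simp
      then show ?thesis using step by blast
    qed simp
    moreover have "A2 = 0 \<or> (\<forall>x :: int. \<exists>t. 0 \<le> t \<and> t \<le> int (card K2 - a2) \<and> odd (x + t) \<noteq> odd x)"
    proof (cases "A2 = 0")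
      case False
      then have "1 \<le> int (card K2 - a2)" using b(2) nonneg(2) by simp
      then show ?thesis using step by blast
    qed simp
    moreover have "odd (x + D) = (\<not> odd x)" for x using False by simp
    ultimately show False
      using antiperiodic_coloring_not_ramsey[where G = odd and D = D, OF K a _ D(2,3) odd] ram by blast
  next
    case True
    define G where "G x = odd (x + x div D)" for x
    have anti: "G (x + D) = (\<not> G x)" for x using D(1) True by (simp add: G_def)
    have run: "\<exists>t. 0 \<le> t \<and> t \<le> b \<and> G (x + t) \<noteq> G x" if "2 \<le> b" for b x
    proof (rule ccontr)
      assume no: "\<not> ?thesis"
      then have "G (x + 1) = G x" "G (x + 2) = G x" using that by (metis order_trans zero_le_one one_le_numeral, metis zero_le_numeral)
      then have "G (x + 1) = G x" "G (x + 1 + 1) = G (x + 1)" by (simp_all add: add.assoc)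
      \<comment> \<open>From \<open>x\<close> to \<open>x + 1\<close> the sum
        \<open>x + x div D\<close> grows by 1, or by 2 exactly when \<open>D\<close> divides
        \<open>x + 1\<close>; only the latter repeats the colour.\<close>
      then have "D dvd x + 1" "D dvd x + 1 + 1"
        unfolding G_def div_add_one[OF D(1)] by (auto split: if_splits)
      then have "D dvd 1" by (metis dvd_add_right_iff)
      then show False using True by (metis dvd_trans odd_one)
    qed
    have even: "even A1" "even A2" using D True by simp_all
    have "A1 = 0 \<or> (\<forall>x. \<exists>t. 0 \<le> t \<and> t \<le> int (card K1 - a1) \<and> G (x + t) \<noteq> G x)"
    proof (cases "A1 = 0")
      case False
      then have "2 \<le> int (card K1 - a1)" using b'(1)[OF even] nonneg(1) by simp
      then show ?thesis using run by blast
    qed simp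
    moreover have "A2 = 0 \<or> (\<forall>x. \<exists>t. 0 \<le> t \<and> t \<le> int (card K2 - a2) \<and> G (x + t) \<noteq> G x)"
    proof (cases "A2 = 0")
      case False
      then have "2 \<le> int (card K2 - a2)" using b'(2)[OF even] nonneg(2) by simp
      then show ?thesis using run by blast
    qed simp
    ultimately show False
      using antiperiodic_coloring_not_ramsey[where G = G and D = D, OF K a anti D(2,3) odd] ram by blast
  qed
qed

text \<open>In the colouring by parity of size, the term \<open>2 * card (S \<inter> Q)\<close> is
  invisible, so the colour of a clique is decided by the parity of \<open>m\<close> plus its
  weight.\<close>

lemma ramsey_weights_same_parity:
  assumes ram: "cube_ramsey 2 d (nsets K1 a1 \<union> nsets K2 a2)"
    and K: "K1 \<subseteq> {1..d}" "K2 \<subseteq> {1..d}" "a1 \<le> card K1" "a2 \<le> card K2"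
  shows "even a1 \<longleftrightarrow> even a2"
proof -
  have sub: "nsets K1 a1 \<union> nsets K2 a2 \<subseteq> cube_verts d"
    using K(1,2) by (auto simp: nsets_def cube_verts_def)
  obtain m Q c where Q: "Q \<subseteq> {1..d}" "card Q \<le> m"
    and mono': "\<forall>S\<in>nsets K1 a1 \<union> nsets K2 a2. even (m + card S - 2 * card (S \<inter> Q)) = c"
    by (rule cube_ramsey_layer_coloring[OF ram sub, of even])
  note mono = bspec[OF mono']
  have "even (m + a) = c" if "S \<in> nsets K1 a1 \<union> nsets K2 a2" "card S = a" "finite S" for S a
  proof -
    have "card (S \<inter> Q) \<le> card S" "card (S \<inter> Q) \<le> card Q"
      using that(3) Q(1) finite_subset[OF Q(1)] by (auto intro: card_mono)
    then have "2 * card (S \<inter> Q) \<le> m + a" using Q(2) that(2) by simp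
    then have "even (m + a - 2 * card (S \<inter> Q)) = even (m + a)" by simp
    then show ?thesis using mono[OF that(1)] that(2) by simp
  qed
  moreover obtain S1 where "S1 \<subseteq> K1" "card S1 = a1" "finite S1"
    using obtain_subset_with_card_n[OF K(3)] .
  moreover obtain S2 where "S2 \<subseteq> K2" "card S2 = a2" "finite S2"
    using obtain_subset_with_card_n[OF K(4)] .
  ultimately have "even (m + a1) = c" "even (m + a2) = c" by (auto simp: nsets_def)
  then show ?thesis by auto
qed

section \<open>The equivalence for three cliques\<close>

lemma cube_ramsey_mono:
  assumes "cube_ramsey t d F'" "F \<subseteq> F'"
  shows "cube_ramsey t d F"
proof -
  have "contains_copy d n F T" if "contains_copy d n F' T" for n T
    using that assms(2) unfolding contains_copy_def by (meson image_mono order_trans)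
  then show ?thesis using assms(1) unfolding cube_ramsey_def by meson
qed

text \<open>\<open>s\<close> is the number of layers per unit, 2 for even and 1 for odd weights. The
  assumptions \<open>shift\<close> translate availability in the sequence into moves of cliques, so
  that both parities share the rest of the argument.\<close>

lemma three_cliques_ramsey_if_good:
  fixes A1 A2 A3 b1 b2 b3 :: int
  assumes K: "K1 \<subseteq> {1..d}" "K2 \<subseteq> {1..d}" "K3 \<subseteq> {1..d}"
    and disj: "K1 \<inter> K2 = {}" "K1 \<inter> K3 = {}" "K2 \<inter> K3 = {}"
    and ok: "pair_ok A1 b1 A2 b2" "pair_ok A1 b1 A3 b3" "pair_ok A2 b2 A3 b3"
    and A: "0 \<le> A1" "A1 \<le> int d" "0 \<le> A2" "A2 \<le> int d" "0 \<le> A3" "A3 \<le> int d"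
    and s: "s > 0"
    and shift: "\<And>f m c. int d \<le> m \<Longrightarrow> avail (\<lambda>y. color_sign (f (nat (s * y)))) A1 b1 m (color_sign c) \<Longrightarrow>
        \<exists>Q\<subseteq>K1. \<forall>S\<in>nsets K1 a1. f (nat (s * m) + card S - 2 * card (S \<inter> Q)) = c"
      "\<And>f m c. int d \<le> m \<Longrightarrow> avail (\<lambda>y. color_sign (f (nat (s * y)))) A2 b2 m (color_sign c) \<Longrightarrow>
        \<exists>Q\<subseteq>K2. \<forall>S\<in>nsets K2 a2. f (nat (s * m) + card S - 2 * card (S \<inter> Q)) = c"
      "\<And>f m c. int d \<le> m \<Longrightarrow> avail (\<lambda>y. color_sign (f (nat (s * y)))) A3 b3 m (color_sign c) \<Longrightarrow>
        \<exists>Q\<subseteq>K3. \<forall>S\<in>nsets K3 a3. f (nat (s * m) + card S - 2 * card (S \<inter> Q)) = c"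
  shows "cube_ramsey 2 d (nsets K1 a1 \<union> nsets K2 a2 \<union> nsets K3 a3)"
proof -
  define P where "P = {(A1, b1), (A2, b2), (A3, b3)}"
  have "\<exists>hi. \<forall>g. sign_seq g \<longrightarrow> (\<exists>m\<in>{int d..hi}. good P g m)"
  proof (rule good_in_bounded_window[of P "int d"])
    show "0 \<le> a \<and> a \<le> int d" if "(a, b) \<in> P" for a b using that A by (auto simp: P_def)
    show "\<exists>m. good P g m" if "N > 0" "\<And>x. g (x + N) = g x" "sign_seq g" for g N
      unfolding P_def by (rule good_if_pairs_ok[OF that(2,1,3) ok])
  qed simp
  then obtain hi where hi: "\<And>g. sign_seq g \<Longrightarrow> \<exists>m\<in>{int d..hi}. good P g m" by blast
  show ?thesis
  proof (rule cube_ramsey_if_layer_colorings[where l = "nat (s * hi)"])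
    show "nsets K1 a1 \<union> nsets K2 a2 \<union> nsets K3 a3 \<subseteq> cube_verts d"
      using K by (auto simp: nsets_def cube_verts_def)
    fix f :: "nat \<Rightarrow> bool"
    obtain m where m: "int d \<le> m" "m \<le> hi" "good P (\<lambda>y. color_sign (f (nat (s * y)))) m"
      using hi[OF sign_seq_color_sign[of "\<lambda>y. f (nat (s * y))"]] by auto
    obtain e where e: "e \<in> {1, -1}" "\<forall>(a, b)\<in>P. avail (\<lambda>y. color_sign (f (nat (s * y)))) a b m e"
      using m(3) unfolding good_def ..
    obtain c where c: "e = color_sign c" using color_sign_cases[OF e(1)] ..
    have av: "avail (\<lambda>y. color_sign (f (nat (s * y)))) A1 b1 m (color_sign c)"
      "avail (\<lambda>y. color_sign (f (nat (s * y)))) A2 b2 m (color_sign c)"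
      "avail (\<lambda>y. color_sign (f (nat (s * y)))) A3 b3 m (color_sign c)"
      using e(2) by (simp_all add: P_def c)
    obtain Q where Q: "Q \<subseteq> K1 \<union> K2 \<union> K3" "\<forall>S\<in>nsets K1 a1 \<union> nsets K2 a2 \<union> nsets K3 a3.
        f (nat (s * m) + card S - 2 * card (S \<inter> Q)) = c"
      using disjoint_cliques_shift[OF shift(1)[OF m(1) av(1)] shift(2)[OF m(1) av(2)]
          shift(3)[OF m(1) av(3)] disj] by (elim exE conjE)
    have "1 * m \<le> s * m" using s m(1) by (intro mult_right_mono) simp_all
    then have "d \<le> nat (s * m)" using m(1) by linarith
    moreover have "nat (s * m) \<le> nat (s * hi)" using s m(2) by (intro nat_mono mult_left_mono) simp_all
    moreover have "Q \<subseteq> {1..d}" using Q(1) K by blast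
    ultimately show "\<exists>m Q c. d \<le> m \<and> m \<le> nat (s * hi) \<and> Q \<subseteq> {1..d} \<and>
        (\<forall>S\<in>nsets K1 a1 \<union> nsets K2 a2 \<union> nsets K3 a3. f (m + card S - 2 * card (S \<inter> Q)) = c)"
      using Q(2) by (intro exI[of _ "nat (s * m)"] exI[of _ Q] exI[of _ c] conjI)
  qed
qed

theorem theorem13:
  fixes d a1 a2 a3 :: nat
    and K1 K2 K3 :: "nat set"
  assumes "d \<ge> 1"
    and "K1 \<subseteq> {1..d}" and "K2 \<subseteq> {1..d}" and "K3 \<subseteq> {1..d}"
    and "K1 \<inter> K2 = {}" and "K1 \<inter> K3 = {}" and "K2 \<inter> K3 = {}"
    and "a1 \<noteq> a2" and "a1 \<noteq> a3" and "a2 \<noteq> a3"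
  shows "cube_ramsey 2 d (nsets K1 a1 \<union> nsets K2 a2 \<union> nsets K3 a3) \<longleftrightarrow>
           cube_ramsey 2 d (nsets K1 a1 \<union> nsets K2 a2) \<and>
           cube_ramsey 2 d (nsets K1 a1 \<union> nsets K3 a3) \<and>
           cube_ramsey 2 d (nsets K2 a2 \<union> nsets K3 a3)"
    (is "?R123 \<longleftrightarrow> ?R12 \<and> ?R13 \<and> ?R23")
proof
  assume ?R123
  then show "?R12 \<and> ?R13 \<and> ?R23" by (auto intro: cube_ramsey_mono)
next
  assume R: "?R12 \<and> ?R13 \<and> ?R23"
  note K = assms(2-4) and disj = assms(5-7)
  have fin: "finite K1" "finite K2" "finite K3" using K by (auto intro: finite_subset)
  have cardd: "card K1 \<le> d" "card K2 \<le> d" "card K3 \<le> d"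
    using K[THEN card_mono[rotated]] by simp_all
  show ?R123
  proof (cases "a1 \<le> card K1 \<and> a2 \<le> card K2 \<and> a3 \<le> card K3")
    case False
    \<comment> \<open>A weight above the order makes the clique empty, and the triple reduces to a
      pair.\<close>
    then have "nsets K1 a1 = {} \<or> nsets K2 a2 = {} \<or> nsets K3 a3 = {}"
      using fin by (auto simp: nsets_eq_empty_iff)
    then show ?thesis using R by auto
  next
    case True
    then have a: "a1 \<le> card K1" "a2 \<le> card K2" "a3 \<le> card K3" by auto
    have par: "even a1 \<longleftrightarrow> even a2" "even a1 \<longleftrightarrow> even a3"
      using R ramsey_weights_same_parity[OF _ K(1,2) a(1,2)]
        ramsey_weights_same_parity[OF _ K(1,3) a(1,3)] by blast+
    show ?thesis
    proof (cases "even a1")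
      case True
      then obtain A1 A2 A3 where "a1 = 2 * A1" "a2 = 2 * A2" "a3 = 2 * A3" using par by (metis evenE)
      then have A: "int a1 = 2 * int A1" "int a2 = 2 * int A2" "int a3 = 2 * int A3" by simp_all
      then have ne: "int A1 \<noteq> int A2" "int A1 \<noteq> int A3" "int A2 \<noteq> int A3" using assms(8-10) by auto
      have le: "int A1 \<le> int d" "int A2 \<le> int d" "int A3 \<le> int d" using A a cardd by linarith+
      show ?thesis
      proof (rule three_cliques_ramsey_if_good[OF K disj, of "int A1" "int (card K1 - a1)" "int A2"
            "int (card K2 - a2)" "int A3" "int (card K3 - a3)" 2])
        show "pair_ok (int A1) (int (card K1 - a1)) (int A2) (int (card K2 - a2))"
          using R by (intro pair_ok_if_ramsey[OF _ K(1,2) a(1,2) A(1,2) ne(1)]) simp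
        show "pair_ok (int A1) (int (card K1 - a1)) (int A3) (int (card K3 - a3))"
          using R by (intro pair_ok_if_ramsey[OF _ K(1,3) a(1,3) A(1,3) ne(2)]) simp
        show "pair_ok (int A2) (int (card K2 - a2)) (int A3) (int (card K3 - a3))"
          using R by (intro pair_ok_if_ramsey[OF _ K(2,3) a(2,3) A(2,3) ne(3)]) simp
      qed (use le in \<open>auto intro!: clique_shift_if_avail fin a A elim: order_trans\<close>)
    next
      case False
      \<comment> \<open>Odd weights have valuation zero, so the pair conditions hold outright and
        extreme positions suffice.\<close>
      then have same: "same_val (int a1) (int a2)" "same_val (int a1) (int a3)" "same_val (int a2) (int a3)"
        using par by (auto intro!: same_val_odd)
      have le: "int a1 \<le> int d" "int a2 \<le> int d" "int a3 \<le> int d" using a cardd by linarith+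
      \<comment> \<open>The run length \<open>2 * a + 1\<close> leaves only the two extreme positions.\<close>
      have unblocked: "\<not> blocked g x m c" if "avail g x (2 * x + 1) m c" for g x m c
        using that by (auto simp: avail_def)
      have shift: "\<exists>Q\<subseteq>K. \<forall>S\<in>nsets K a. f (nat (1 * m) + card S - 2 * card (S \<inter> Q)) = c"
        if "finite K" "a \<le> card K" "int a \<le> int d" "int d \<le> m"
          "avail (\<lambda>y. color_sign (f (nat (1 * y)))) (int a) (2 * int a + 1) m (color_sign c)"
        for K a f m c
        using clique_shift_if_unblocked[OF that(1,2) order_trans[OF that(3,4)], of f c]
          unblocked[OF that(5)] by simp
      show ?thesis
        by (rule three_cliques_ramsey_if_good[OF K disj, of "int a1" "2 * int a1 + 1" "int a2"
              "2 * int a2 + 1" "int a3" "2 * int a3 + 1" 1])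
          (use same le in \<open>simp_all add: pair_ok_def del: mult_1\<close>,
            use shift fin a le in \<open>blast+\<close>)
    qed
  qed
qed

end
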